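(* Let $\mathcal{L}$ be the normalized Laplace operator on $\ell^2(\mathbb{Z})$, $\mathcal{L}f(n)=\frac12\bigl(2f(n)-f(n+1)-f(n-1)\bigr)$, let $\mathcal{F}:\ell^2(\mathbb{Z})\to L^2(\mathbb{T})$ be the Fourier transform, let $X=L^2([0,2],\mathbb{C}^2;\mu)$, and let $W:L^2(\mathbb{T})\to X$ be the operator $$(Wg)(z)=\Bigl(g\bigl(\tfrac{1}{2\pi}\arccos(1-z)\bigr),\ g\bigl(1-\tfrac{1}{2\pi}\arccos(1-z)\bigr)\Bigr),\qquad g\in L^2(\mathbb{T}),\ z\in[0,2).$$ Then the operator $\mathcal{U}:=W\mathcal{F}:\ell^2(\mathbb{Z})\to X$ is unitary. Furthermore $$\mathcal{L}=\mathcal{U}^{-1}M_z\,\mathcal{U},$$ where $M_z:X\to X$ is the operator of multiplication by the independent variable, $(M_zh)(z)=z\,h(z)$.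
   Context: $\mathbb{T}$ is identified with $[-1/2,1/2)$ with addition modulo $1$ and normalized Haar (Lebesgue) measure $d\xi$; functions on $\mathbb{T}$ are regarded as $1$-periodic functions on $\mathbb{R}$. The Fourier transform is the unitary operator $\mathcal{F}:\ell^2(\mathbb{Z})\to L^2(\mathbb{T})$, $\mathcal{F}f(\xi)=\sum_{k\in\mathbb{Z}}f(k)e^{2\pi i k\xi}$. The measure $\mu$ on $[0,2]$ is given by $d\mu(z)=\frac{1}{2\pi}\frac{dz}{\sqrt{z(2-z)}}$, and $X=L^2([0,2],\mathbb{C}^2;\mu)=L^2([0,2],\mu)\oplus L^2([0,2],\mu)$. *)

theory Defs
  imports "HOL-Analysis.Analysis"
begin

text \<open>
  Complex inner product spaces on an explicit carrier; the inner product is linear in its first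
  argument.
\<close>

record 'v ips =
  vcarrier :: "'v set"
  vadd :: "'v \<Rightarrow> 'v \<Rightarrow> 'v"
  vscale :: "complex \<Rightarrow> 'v \<Rightarrow> 'v"
  vinner :: "'v \<Rightarrow> 'v \<Rightarrow> complex"

definition unitary_op :: "'v ips \<Rightarrow> 'w ips \<Rightarrow> ('v \<Rightarrow> 'w) \<Rightarrow> bool" where
  "unitary_op V W T \<longleftrightarrow>
     bij_betw T (vcarrier V) (vcarrier W) \<and>
     (\<forall>x\<in>vcarrier V. \<forall>y\<in>vcarrier V. T (vadd V x y) = vadd W (T x) (T y)) \<and>
     (\<forall>c. \<forall>x\<in>vcarrier V. T (vscale V c x) = vscale W c (T x)) \<and>
     (\<forall>x\<in>vcarrier V. \<forall>y\<in>vcarrier V. vinner W (T x) (T y) = vinner V x y)"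

definition C1 :: "complex ips" where
  "C1 = \<lparr>vcarrier = UNIV, vadd = (+), vscale = (*), vinner = (\<lambda>a b. a * cnj b)\<rparr>"

definition C2 :: "(complex \<times> complex) ips" where
  "C2 = \<lparr>vcarrier = UNIV, vadd = (+),
         vscale = (\<lambda>c (a, b). (c * a, c * b)),
         vinner = (\<lambda>(a, b) (a', b'). a * cnj a' + b * cnj b')\<rparr>"

definition ell2 :: "(int \<Rightarrow> complex) ips" where
  "ell2 = \<lparr>vcarrier = {f. (\<lambda>k. (cmod (f k))\<^sup>2) summable_on UNIV},
           vadd = (\<lambda>f g k. f k + g k),
           vscale = (\<lambda>c f k. c * f k),
           vinner = (\<lambda>f g. \<Sum>\<^sub>\<infinity>k. f k * cnj (g k))\<rparr>"

definition L2_fun :: "'a measure \<Rightarrow> ('a \<Rightarrow> 'b::{banach, second_countable_topology}) set" where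
  "L2_fun M = {f \<in> borel_measurable M. integrable M (\<lambda>x. (norm (f x))\<^sup>2)}"

definition ae_class ::
    "'a measure \<Rightarrow> ('a \<Rightarrow> 'b::{banach, second_countable_topology}) \<Rightarrow> ('a \<Rightarrow> 'b) set" where
  "ae_class M f = {g \<in> L2_fun M. AE x in M. f x = g x}"

text \<open>
  The space of square integrable functions with values in \<open>H\<close> (below: \<open>C1\<close> or \<open>C2\<close>, whose inner
  products induce the norms of their types). Its elements are the classes of almost everywhere
  equal functions, and a union over the representatives of a class, as in
  \<^theory>\<open>HOL.Equiv_Relations\<close>, applies an operation defined on functions to that class.
\<close>

definition L2 ::
    "'a measure \<Rightarrow> 'b::{banach, second_countable_topology} ips \<Rightarrow> ('a \<Rightarrow> 'b) set ips" where
  "L2 M H =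
     \<lparr>vcarrier = ae_class M ` L2_fun M,
      vadd = (\<lambda>F G. \<Union>f\<in>F. \<Union>g\<in>G. ae_class M (\<lambda>x. vadd H (f x) (g x))),
      vscale = (\<lambda>c F. \<Union>f\<in>F. ae_class M (\<lambda>x. vscale H c (f x))),
      vinner = (\<lambda>F G. the_elem (\<Union>f\<in>F. \<Union>g\<in>G. {LINT x|M. vinner H (f x) (g x)}))\<rparr>"

definition torus :: "real measure" where
  "torus = restrict_space lborel {-1/2..<1/2}"

text \<open>\<open>frac (x + 1/2) - 1/2\<close> is the point of \<open>[-1/2, 1/2)\<close> congruent to \<open>x\<close> modulo 1.\<close>

definition periodic_ext :: "(real \<Rightarrow> 'b) \<Rightarrow> real \<Rightarrow> 'b" where
  "periodic_ext g x = g (frac (x + 1/2) - 1/2)"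

definition L2T :: "(real \<Rightarrow> complex) set ips" where
  "L2T = L2 torus C1"

text \<open>
  The series \<open>\<Sum>k. f k * exp (2 * pi * i * k * \<xi>)\<close> converges (unconditionally) in the mean, in
  general not pointwise.
\<close>

definition fourier :: "(int \<Rightarrow> complex) \<Rightarrow> (real \<Rightarrow> complex) set" where
  "fourier f = (THE G. G \<in> vcarrier L2T \<and>
     (\<forall>g\<in>G. ((\<lambda>S. LINT \<xi>|torus.
          (cmod (g \<xi> - (\<Sum>k\<in>S. f k * exp (2 * of_real pi * \<i> * of_int k * of_real \<xi>))))\<^sup>2)
        \<longlongrightarrow> 0) (finite_subsets_at_top UNIV)))"

definition mu :: "real measure" where
  "mu = density (restrict_space lborel {0..2})
          (\<lambda>z. ennreal (1 / (2 * pi) * (1 / sqrt (z * (2 - z)))))"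

definition X :: "(real \<Rightarrow> complex \<times> complex) set ips" where
  "X = L2 mu C2"

definition W :: "(real \<Rightarrow> complex) set \<Rightarrow> (real \<Rightarrow> complex \<times> complex) set" where
  "W G = (\<Union>g\<in>G. ae_class mu
     (\<lambda>z. (periodic_ext g (1 / (2 * pi) * arccos (1 - z)),
           periodic_ext g (1 - 1 / (2 * pi) * arccos (1 - z)))))"

definition Mz :: "(real \<Rightarrow> complex \<times> complex) set \<Rightarrow> (real \<Rightarrow> complex \<times> complex) set" where
  "Mz F = (\<Union>h\<in>F. ae_class mu (\<lambda>z. z *\<^sub>R h z))"

definition U :: "(int \<Rightarrow> complex) \<Rightarrow> (real \<Rightarrow> complex \<times> complex) set" where
  "U = W \<circ> fourier"

definition laplace :: "(int \<Rightarrow> complex) \<Rightarrow> int \<Rightarrow> complex" where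
  "laplace f n = 1/2 * (2 * f n - f (n + 1) - f (n - 1))"

end

theory Submission
  imports Defs
begin

text \<open>
  In Fourier space a shift of \<open>\<int>\<close> becomes multiplication by a character, so \<open>laplace\<close> becomes
  multiplication by \<open>symbol x = 1 - cos (2 * pi * x)\<close>. This function is even and maps each half of
  the torus bijectively onto \<open>[0, 2]\<close>, up to endpoints. Taking its value as the new coordinate on
  each half turns it into the independent variable and the torus into two copies of \<open>[0, 2]\<close>; the
  measure \<open>mu\<close> is exactly the image of Lebesgue measure on one half (\<open>mu_eq_distr\<close>). This is why \<open>W\<close> is
  unitary (\<open>unitary_W\<close>) and carries \<open>symbol\<close> to the variable \<open>z\<close> (\<open>W_symbol_mult\<close>).

  The analytic substance is the unitarity of the Fourier transform (\<open>unitary_fourier\<close>). It is read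
  off from the inverse map, which sends \<open>g\<close> to its sequence of Fourier coefficients. That map takes
  square integrable functions to square summable sequences by Bessel's inequality
  (\<open>fourier_coeff_ell2\<close>), it is onto by completeness of \<open>L\<^sup>2\<close> (\<open>Riesz_Fischer\<close>), and it is injective
  because the trigonometric system is complete (\<open>fourier_coeff_unique\<close>). Once \<open>fourier\<close> is known to
  invert it (\<open>fourier_fourier_coeff\<close>), every algebraic property of \<open>fourier\<close> can be checked on
  coefficients, where it is a property of the inner product. In particular the conjugation of
  \<open>laplace\<close> into multiplication by \<open>symbol\<close> is the computation of the coefficients of a product
  (\<open>fourier_coeff_symbol_mult\<close>).

  Injectivity is proved by enlarging the class of functions against which an \<open>h\<close> with vanishing
  coefficients integrates to zero: from characters to continuous functions of the point of the
  unit circle by the Stone--Weierstrass theorem, to indicators of closed sets by dominated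
  convergence, and to indicators of all Borel sets by Dynkin's \<open>\<pi>\<close>-\<open>\<lambda>\<close> theorem.
\<close>

section \<open>Square integrable functions and their classes\<close>

lemma L2_funD:
  assumes "f \<in> L2_fun M"
  shows "f \<in> borel_measurable M" "integrable M (\<lambda>x. (norm (f x))\<^sup>2)"
  using assms by (auto simp: L2_fun_def)

lemma L2_fun_dominated:
  assumes "f \<in> L2_fun M" "g \<in> borel_measurable M"
    and "AE x in M. norm (g x) \<le> C * norm (f x)"
  shows "g \<in> L2_fun M"
proof -
  note [measurable] = L2_funD(1)[OF assms(1)] assms(2)
  have "integrable M (\<lambda>x. C\<^sup>2 * (norm (f x))\<^sup>2)"
    using L2_funD(2)[OF assms(1)] by simp
  then have "integrable M (\<lambda>x. (norm (g x))\<^sup>2)"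
  proof (rule Bochner_Integration.integrable_bound)
    show "AE x in M. norm ((norm (g x))\<^sup>2) \<le> norm (C\<^sup>2 * (norm (f x))\<^sup>2)"
      using assms(3)
    proof eventually_elim
      case (elim x)
      then have "(norm (g x))\<^sup>2 \<le> (C * norm (f x))\<^sup>2"
        by (intro power_mono) auto
      then show ?case by (simp add: power_mult_distrib)
    qed
  qed measurable
  then show ?thesis using assms(2) by (simp add: L2_fun_def)
qed

lemma L2_fun_add:
  assumes "f \<in> L2_fun M" "g \<in> L2_fun M"
  shows "(\<lambda>x. f x + g x) \<in> L2_fun M"
proof -
  note [measurable] = L2_funD(1)[OF assms(1)] L2_funD(1)[OF assms(2)]
  have "integrable M (\<lambda>x. 2 * (norm (f x))\<^sup>2 + 2 * (norm (g x))\<^sup>2)"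
    using L2_funD(2)[OF assms(1)] L2_funD(2)[OF assms(2)] by simp
  then have "integrable M (\<lambda>x. (norm (f x + g x))\<^sup>2)"
  proof (rule Bochner_Integration.integrable_bound)
    have "(norm (f x + g x))\<^sup>2 \<le> 2 * (norm (f x))\<^sup>2 + 2 * (norm (g x))\<^sup>2" for x
    proof -
      have "(norm (f x + g x))\<^sup>2 \<le> (norm (f x) + norm (g x))\<^sup>2"
        by (intro power_mono norm_triangle_ineq norm_ge_zero)
      also have "\<dots> \<le> 2 * (norm (f x))\<^sup>2 + 2 * (norm (g x))\<^sup>2"
        using zero_le_power2[of "norm (f x) - norm (g x)"]
        by (simp add: power2_eq_square algebra_simps)
      finally show ?thesis .
    qed
    then show "AE x in M. norm ((norm (f x + g x))\<^sup>2)
        \<le> norm (2 * (norm (f x))\<^sup>2 + 2 * (norm (g x))\<^sup>2)"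
      by simp
  qed measurable
  then show ?thesis by (simp add: L2_fun_def)
qed

lemma L2_fun_bounded_mult:
  fixes f :: "'a \<Rightarrow> 'b::{real_normed_algebra, banach, second_countable_topology}"
  assumes "f \<in> L2_fun M" "c \<in> borel_measurable M" "\<And>x. x \<in> space M \<Longrightarrow> norm (c x) \<le> C"
  shows "(\<lambda>x. c x * f x) \<in> L2_fun M"
proof (rule L2_fun_dominated[OF assms(1)])
  note [measurable] = L2_funD(1)[OF assms(1)] assms(2)
  show "(\<lambda>x. c x * f x) \<in> borel_measurable M" by measurable
  show "AE x in M. norm (c x * f x) \<le> C * norm (f x)"
    by (intro AE_I2 order_trans[OF norm_mult_ineq] mult_right_mono assms(3)) auto
qed

lemma L2_fun_cmult:
  fixes f :: "'a \<Rightarrow> 'b::{real_normed_algebra, banach, second_countable_topology}"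
  assumes "f \<in> L2_fun M"
  shows "(\<lambda>x. c * f x) \<in> L2_fun M"
  by (rule L2_fun_bounded_mult[OF assms, of _ "norm c"]) auto

lemma L2_fun_diff:
  fixes f :: "'a \<Rightarrow> complex"
  assumes "f \<in> L2_fun M" "g \<in> L2_fun M"
  shows "(\<lambda>x. f x - g x) \<in> L2_fun M"
  using L2_fun_add[OF assms(1) L2_fun_cmult[OF assms(2), of "-1"]] by simp

lemma L2_fun_zero: "(\<lambda>x. 0) \<in> L2_fun M"
  by (simp add: L2_fun_def)

lemma L2_fun_sum:
  assumes "\<And>k. k \<in> S \<Longrightarrow> f k \<in> L2_fun M"
  shows "(\<lambda>x. \<Sum>k\<in>S. f k x) \<in> L2_fun M"
proof (cases "finite S")
  case True
  then show ?thesis using assms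
    by (induction rule: finite_induct) (auto intro: L2_fun_add simp: L2_fun_zero)
qed (simp add: L2_fun_zero)

lemma L2_fun_AE_cong:
  assumes "f \<in> L2_fun M" "g \<in> borel_measurable M" "AE x in M. f x = g x"
  shows "g \<in> L2_fun M"
  by (rule L2_fun_dominated[OF assms(1,2), of 1]) (use assms(3) in auto)

lemma ae_class_cong:
  assumes "AE x in M. f x = g x"
  shows "ae_class M f = ae_class M g"
proof -
  have "(AE x in M. f x = h x) \<longleftrightarrow> (AE x in M. g x = h x)" for h
    by (rule eventually_cong[OF assms]) simp
  then show ?thesis by (simp add: ae_class_def)
qed

lemma mem_ae_class_self: "f \<in> L2_fun M \<Longrightarrow> f \<in> ae_class M f"
  by (simp add: ae_class_def)

lemma ae_class_eq_iff:
  assumes "f \<in> L2_fun M" "g \<in> L2_fun M"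
  shows "ae_class M f = ae_class M g \<longleftrightarrow> (AE x in M. f x = g x)"
proof
  assume "ae_class M f = ae_class M g"
  then have "g \<in> ae_class M f" using mem_ae_class_self[OF assms(2)] by simp
  then show "AE x in M. f x = g x" by (simp add: ae_class_def)
qed (rule ae_class_cong)

text \<open>An operation on functions that respects almost everywhere equality descends to classes,
  and the union over representatives then collapses to the class of any one of them.\<close>

lemma UN_ae_class:
  assumes "f \<in> L2_fun M"
    and "\<And>g. g \<in> L2_fun M \<Longrightarrow> AE x in M. f x = g x \<Longrightarrow> AE x in N. \<Phi> f x = \<Phi> g x"
  shows "(\<Union>g\<in>ae_class M f. ae_class N (\<Phi> g)) = ae_class N (\<Phi> f)"
proof -
  have "ae_class N (\<Phi> g) = ae_class N (\<Phi> f)" if "g \<in> ae_class M f" for g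
    using ae_class_cong[OF assms(2), of g] that by (auto simp: ae_class_def)
  moreover have "f \<in> ae_class M f" by (rule mem_ae_class_self[OF assms(1)])
  ultimately show ?thesis by (intro UN_constant_eq) blast+
qed

lemma vcarrier_L2: "vcarrier (L2 M H) = ae_class M ` L2_fun M"
  by (simp add: L2_def)

lemma vadd_L2:
  assumes "f \<in> L2_fun M" "g \<in> L2_fun M"
  shows "vadd (L2 M H) (ae_class M f) (ae_class M g) = ae_class M (\<lambda>x. vadd H (f x) (g x))"
proof -
  have "(\<Union>g'\<in>ae_class M g. ae_class M (\<lambda>x. vadd H (f' x) (g' x)))
      = ae_class M (\<lambda>x. vadd H (f' x) (g x))" for f'
    by (rule UN_ae_class[OF assms(2)]) (erule eventually_mono, simp)
  moreover have "(\<Union>f'\<in>ae_class M f. ae_class M (\<lambda>x. vadd H (f' x) (g x)))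
      = ae_class M (\<lambda>x. vadd H (f x) (g x))"
    by (rule UN_ae_class[OF assms(1)]) (erule eventually_mono, simp)
  ultimately show ?thesis
    by (simp add: L2_def)
qed

lemma vscale_L2:
  assumes "f \<in> L2_fun M"
  shows "vscale (L2 M H) c (ae_class M f) = ae_class M (\<lambda>x. vscale H c (f x))"
proof -
  have "(\<Union>g\<in>ae_class M f. ae_class M (\<lambda>x. vscale H c (g x)))
      = ae_class M (\<lambda>x. vscale H c (f x))"
    by (rule UN_ae_class[OF assms]) (erule eventually_mono, simp)
  then show ?thesis by (simp add: L2_def)
qed

lemma vinner_L2:
  assumes f: "f \<in> L2_fun M" and g: "g \<in> L2_fun M"
    and meas: "\<And>f g. f \<in> borel_measurable M \<Longrightarrow> g \<in> borel_measurable M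
      \<Longrightarrow> (\<lambda>x. vinner H (f x) (g x)) \<in> borel_measurable M"
  shows "vinner (L2 M H) (ae_class M f) (ae_class M g) = (LINT x|M. vinner H (f x) (g x))"
proof -
  have "(LINT x|M. vinner H (f' x) (g' x)) = (LINT x|M. vinner H (f x) (g x))"
    if "f' \<in> ae_class M f" "g' \<in> ae_class M g" for f' g'
  proof (rule integral_cong_AE)
    have "AE x in M. f x = f' x" "AE x in M. g x = g' x"
      using that by (auto simp: ae_class_def)
    then show "AE x in M. vinner H (f' x) (g' x) = vinner H (f x) (g x)"
      by eventually_elim simp
  qed (use that f g in \<open>auto intro!: meas simp: ae_class_def dest: L2_funD(1)\<close>)
  then have "(\<Union>f'\<in>ae_class M f. \<Union>g'\<in>ae_class M g. {LINT x|M. vinner H (f' x) (g' x)})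
      = {LINT x|M. vinner H (f x) (g x)}"
    using mem_ae_class_self[OF f] mem_ae_class_self[OF g]
    by (intro UN_constant_eq) blast+
  then show ?thesis by (simp add: L2_def)
qed

section \<open>The inner product of square integrable functions\<close>

lemma borel_measurable_cnj [measurable (raw)]:
  "f \<in> borel_measurable M \<Longrightarrow> (\<lambda>x. cnj (f x)) \<in> borel_measurable M"
  by (rule borel_measurable_continuous_on[OF continuous_on_cnj[OF continuous_on_id]])

definition l2_inner :: "'a measure \<Rightarrow> ('a \<Rightarrow> complex) \<Rightarrow> ('a \<Rightarrow> complex) \<Rightarrow> complex" where
  "l2_inner M f g = (LINT x|M. f x * cnj (g x))"

lemma integrable_mult_cnj:
  fixes f g :: "'a \<Rightarrow> complex"
  assumes "f \<in> L2_fun M" "g \<in> L2_fun M"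
  shows "integrable M (\<lambda>x. f x * cnj (g x))"
proof -
  note [measurable] = L2_funD(1)[OF assms(1)] L2_funD(1)[OF assms(2)]
  have "integrable M (\<lambda>x. (cmod (f x))\<^sup>2 + (cmod (g x))\<^sup>2)"
    using L2_funD(2)[OF assms(1)] L2_funD(2)[OF assms(2)] by simp
  then show ?thesis
  proof (rule Bochner_Integration.integrable_bound)
    have "cmod (f x) * cmod (g x) \<le> (cmod (f x))\<^sup>2 + (cmod (g x))\<^sup>2" for x
      using zero_le_power2[of "cmod (f x) - cmod (g x)"]
        mult_nonneg_nonneg[OF norm_ge_zero norm_ge_zero, of "f x" "g x"]
      by (simp only: power2_diff mult.assoc)
    then show "AE x in M. norm (f x * cnj (g x)) \<le> norm ((cmod (f x))\<^sup>2 + (cmod (g x))\<^sup>2)"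
      by (simp add: norm_mult)
  qed measurable
qed

lemma l2_inner_add_left:
  "f \<in> L2_fun M \<Longrightarrow> g \<in> L2_fun M \<Longrightarrow> h \<in> L2_fun M \<Longrightarrow>
    l2_inner M (\<lambda>x. f x + g x) h = l2_inner M f h + l2_inner M g h"
  by (simp add: l2_inner_def ring_distribs integrable_mult_cnj)

lemma l2_inner_diff_left:
  "f \<in> L2_fun M \<Longrightarrow> g \<in> L2_fun M \<Longrightarrow> h \<in> L2_fun M \<Longrightarrow>
    l2_inner M (\<lambda>x. f x - g x) h = l2_inner M f h - l2_inner M g h"
  by (simp add: l2_inner_def left_diff_distrib integrable_mult_cnj)

lemma l2_inner_cmult_left: "l2_inner M (\<lambda>x. c * f x) h = c * l2_inner M f h"
  by (simp add: l2_inner_def mult.assoc)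

lemma l2_inner_sum_left:
  assumes "\<And>k. k \<in> S \<Longrightarrow> f k \<in> L2_fun M" "h \<in> L2_fun M"
  shows "l2_inner M (\<lambda>x. \<Sum>k\<in>S. f k x) h = (\<Sum>k\<in>S. l2_inner M (f k) h)"
  using assms by (simp add: l2_inner_def sum_distrib_right integrable_mult_cnj)

lemma l2_inner_commute: "l2_inner M g f = cnj (l2_inner M f g)"
  using Bochner_Integration.integral_cnj[of M "\<lambda>x. f x * cnj (g x)"]
  by (simp add: l2_inner_def mult.commute)

lemma l2_inner_cong_AE:
  assumes "AE x in M. f x = f' x" "f \<in> L2_fun M" "f' \<in> L2_fun M" "h \<in> L2_fun M"
  shows "l2_inner M f h = l2_inner M f' h"
proof -
  note [measurable] = assms(2-4)[THEN L2_funD(1)]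
  show ?thesis
    unfolding l2_inner_def
  proof (rule integral_cong_AE)
    show "AE x in M. f x * cnj (h x) = f' x * cnj (h x)"
      using assms(1) by eventually_elim simp
  qed measurable
qed

lemma l2_inner_self: "l2_inner M f f = of_real (LINT x|M. (cmod (f x))\<^sup>2)"
  unfolding l2_inner_def complex_norm_square[symmetric] by (rule integral_complex_of_real)

lemma l2_Cauchy_Schwarz_real:
  fixes f g :: "'a \<Rightarrow> complex"
  assumes "f \<in> L2_fun M" "g \<in> L2_fun M"
  shows "(LINT x|M. cmod (f x) * cmod (g x))\<^sup>2
    \<le> (LINT x|M. (cmod (f x))\<^sup>2) * (LINT x|M. (cmod (g x))\<^sup>2)"
proof -
  note [measurable] = L2_funD(1)[OF assms(1)] L2_funD(1)[OF assms(2)]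
  have "integrable M (\<lambda>x. cmod (f x) * cmod (g x))"
    using integrable_norm[OF integrable_mult_cnj[OF assms]] by (simp add: norm_mult)
  then have 1: "(\<integral>\<^sup>+x. ennreal (cmod (f x)) * ennreal (cmod (g x)) \<partial>M)
      = ennreal (LINT x|M. cmod (f x) * cmod (g x))"
    by (subst nn_integral_eq_integral[symmetric]) (auto simp: ennreal_mult)
  have 2: "(\<integral>\<^sup>+x. (ennreal (cmod (h x)))\<^sup>2 \<partial>M) = ennreal (LINT x|M. (cmod (h x))\<^sup>2)"
    if "h \<in> L2_fun M" for h :: "'a \<Rightarrow> complex"
    using L2_funD(2)[OF that]
    by (subst nn_integral_eq_integral[symmetric]) (auto simp: ennreal_power)
  have "(\<integral>\<^sup>+x. ennreal (cmod (f x)) * ennreal (cmod (g x)) \<partial>M)\<^sup>2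
      \<le> (\<integral>\<^sup>+x. (ennreal (cmod (f x)))\<^sup>2 \<partial>M) * (\<integral>\<^sup>+x. (ennreal (cmod (g x)))\<^sup>2 \<partial>M)"
    by (rule Cauchy_Schwarz_nn_integral) measurable
  then show ?thesis
    unfolding 1 2[OF assms(1)] 2[OF assms(2)]
    by (simp add: ennreal_power flip: ennreal_mult)
qed

lemma l2_Cauchy_Schwarz:
  assumes "f \<in> L2_fun M" "g \<in> L2_fun M"
  shows "cmod (l2_inner M f g)
    \<le> sqrt (LINT x|M. (cmod (f x))\<^sup>2) * sqrt (LINT x|M. (cmod (g x))\<^sup>2)"
proof -
  have "cmod (l2_inner M f g) \<le> (LINT x|M. cmod (f x) * cmod (g x))"
    using integral_norm_bound[of M "\<lambda>x. f x * cnj (g x)"]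
    by (simp add: l2_inner_def norm_mult)
  also have "\<dots> \<le> sqrt ((LINT x|M. (cmod (f x))\<^sup>2) * (LINT x|M. (cmod (g x))\<^sup>2))"
    by (rule real_le_rsqrt[OF l2_Cauchy_Schwarz_real[OF assms]])
  finally show ?thesis by (simp add: real_sqrt_mult)
qed

lemma l2_norm_diff:
  fixes f g :: "'a \<Rightarrow> complex"
  assumes "f \<in> L2_fun M" "g \<in> L2_fun M"
  shows "(LINT x|M. (cmod (f x - g x))\<^sup>2)
    = (LINT x|M. (cmod (f x))\<^sup>2) + (LINT x|M. (cmod (g x))\<^sup>2) - 2 * Re (l2_inner M f g)"
proof -
  have *: "(cmod (f x - g x))\<^sup>2
      = (cmod (f x))\<^sup>2 + (cmod (g x))\<^sup>2 - 2 * Re (f x * cnj (g x))" for x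
    unfolding cmod_power2 by (simp add: power2_eq_square algebra_simps)
  note int = L2_funD(2)[OF assms(1)] L2_funD(2)[OF assms(2)] integrable_mult_cnj[OF assms]
  have "integrable M (\<lambda>x. 2 * Re (f x * cnj (g x)))"
    using int(3) by (intro integrable_mult_right integrable_Re)
  moreover have "(LINT x|M. 2 * Re (f x * cnj (g x))) = 2 * Re (l2_inner M f g)"
    unfolding l2_inner_def using integral_Re[OF int(3)] by (simp del: times_complex.sel)
  ultimately show ?thesis
    unfolding * using int(1,2) by (simp del: times_complex.sel)
qed

text \<open>A triangle inequality for squared norms. The factor 2 is harmless in limits and avoids square
  roots.\<close>

lemma l2_triangle_diff:
  fixes f g h :: "'a \<Rightarrow> complex"
  assumes "f \<in> L2_fun M" "g \<in> L2_fun M" "h \<in> L2_fun M"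
  shows "(LINT x|M. (cmod (f x - h x))\<^sup>2)
    \<le> 2 * (LINT x|M. (cmod (f x - g x))\<^sup>2) + 2 * (LINT x|M. (cmod (g x - h x))\<^sup>2)"
proof -
  note int = L2_fun_diff[OF assms(1,2), THEN L2_funD(2)] L2_fun_diff[OF assms(2,3), THEN L2_funD(2)]
    L2_fun_diff[OF assms(1,3), THEN L2_funD(2)]
  have *: "(cmod (f x - h x))\<^sup>2 \<le> 2 * (cmod (f x - g x))\<^sup>2 + 2 * (cmod (g x - h x))\<^sup>2" for x
  proof -
    have "(cmod (f x - h x))\<^sup>2 \<le> (cmod (f x - g x) + cmod (g x - h x))\<^sup>2"
      using norm_triangle_ineq[of "f x - g x" "g x - h x"] by (intro power_mono) auto
    also have "\<dots> \<le> 2 * (cmod (f x - g x))\<^sup>2 + 2 * (cmod (g x - h x))\<^sup>2"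
      using zero_le_power2[of "cmod (f x - g x) - cmod (g x - h x)"]
      by (simp add: power2_eq_square algebra_simps)
    finally show ?thesis .
  qed
  have "(LINT x|M. (cmod (f x - h x))\<^sup>2)
      \<le> (LINT x|M. 2 * (cmod (f x - g x))\<^sup>2 + 2 * (cmod (g x - h x))\<^sup>2)"
    using int * by (intro integral_mono) auto
  then show ?thesis using int(1,2) by simp
qed

section \<open>Trigonometric polynomials on the torus\<close>

lemma space_torus: "space torus = {-1/2..<1/2}"
  by (simp add: torus_def space_restrict_space)

lemma sets_torus: "sets torus = sets (restrict_space borel {-1/2..<1/2})"
  unfolding torus_def by (rule sets_restrict_space_cong) simp

lemma measurable_torusI: "f \<in> borel_measurable borel \<Longrightarrow> f \<in> borel_measurable torus"
  unfolding torus_def by (rule measurable_restrict_space1) simp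

lemma prob_space_torus: "emeasure torus (space torus) = 1"
  unfolding space_torus unfolding torus_def by (subst emeasure_restrict_space) auto

interpretation torus: finite_measure torus
  by standard (simp add: prob_space_torus)

lemma measure_torus: "measure torus (space torus) = 1"
  by (simp add: measure_def prob_space_torus)

lemma AE_torusI: "AE x in lborel. x \<in> {-1/2..<1/2} \<longrightarrow> P x \<Longrightarrow> AE x in torus. P x"
  unfolding torus_def by (subst AE_restrict_space_iff) auto

definition trig :: "int \<Rightarrow> real \<Rightarrow> complex" where
  "trig k x = exp (2 * of_real pi * \<i> * of_int k * of_real x)"

lemma trig_cis: "trig k x = cis (2 * pi * of_int k * x)"
  by (simp add: trig_def cis_conv_exp mult_ac)

lemma norm_trig [simp]: "cmod (trig k x) = 1"
  by (simp add: trig_cis)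

lemma trig_0 [simp]: "trig 0 x = 1"
  by (simp add: trig_cis)

lemma cnj_trig: "cnj (trig k x) = trig (- k) x"
  by (simp add: trig_cis cis_cnj)

lemma trig_mult: "trig k x * trig l x = trig (k + l) x"
  by (simp add: trig_cis cis_mult ring_distribs)

lemma borel_measurable_trig [measurable]: "trig k \<in> borel_measurable torus"
  unfolding trig_def by (rule measurable_torusI) measurable

lemma trig_L2 [simp]: "trig k \<in> L2_fun torus"
  by (simp add: L2_fun_def)

text \<open>A nontrivial character takes the same value at both endpoints, and so does its antiderivative.\<close>

lemma integral_trig: "(LINT x|torus. trig k x) = of_bool (k = 0)"
proof (cases "k = 0")
  case True
  then show ?thesis by (simp add: measure_torus)
next
  case False
  define F where "F x = trig k x / (2 * of_real pi * \<i> * of_int k)" for x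
  have "(LINT x|torus. trig k x) = (LINT x|lborel. indicator {-1/2..<1/2} x *\<^sub>R trig k x)"
    unfolding torus_def by (subst integral_restrict_space) auto
  also have "\<dots> = (LINT x|lborel. indicator {-1/2..1/2} x *\<^sub>R trig k x)"
  proof (rule integral_cong_AE)
    have "AE x in lborel. x \<noteq> (1/2::real)" by (rule AE_lborel_singleton)
    then show "AE x in lborel. indicator {-1/2..<1/2} x *\<^sub>R trig k x
        = indicator {-1/2..1/2} x *\<^sub>R trig k x"
      by eventually_elim (auto simp: indicator_def)
  qed (auto simp: trig_def)
  also have "\<dots> = F (1/2) - F (-1/2)"
  proof (rule integral_FTC_Icc)
    show "(F has_vector_derivative trig k x) (at x within {-1/2..1/2})" for x
      unfolding F_def trig_def using False
      by (intro has_vector_derivative_real_field) (auto intro!: derivative_eq_intros)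
    show "continuous_on {-1/2..1/2} (trig k)"
      unfolding trig_def by (intro continuous_intros)
  qed simp
  also have "trig k (1/2) = trig k (-1/2)"
  proof -
    have "trig k (1/2) = cis (2 * pi * of_int k) * trig k (-1/2)"
      unfolding trig_cis cis_mult by (simp add: algebra_simps)
    also have "cis (2 * pi * of_int k) = 1"
      by (rule cis_multiple_2pi) auto
    finally show ?thesis by simp
  qed
  then have "F (1/2) - F (-1/2) = 0" by (simp add: F_def)
  finally show ?thesis using False by simp
qed

lemma l2_inner_trig: "l2_inner torus (trig k) (trig l) = of_bool (k = l)"
  using integral_trig[of "k - l"] by (simp add: l2_inner_def cnj_trig trig_mult)

definition trig_poly :: "(int \<Rightarrow> complex) \<Rightarrow> int set \<Rightarrow> real \<Rightarrow> complex" where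
  "trig_poly c S x = (\<Sum>k\<in>S. c k * trig k x)"

lemma trig_poly_L2 [simp]: "trig_poly c S \<in> L2_fun torus"
  unfolding trig_poly_def[abs_def] by (intro L2_fun_sum L2_fun_cmult trig_L2)

lemma l2_inner_trig_poly:
  assumes "h \<in> L2_fun torus"
  shows "l2_inner torus (trig_poly c S) h = (\<Sum>k\<in>S. c k * l2_inner torus (trig k) h)"
  unfolding trig_poly_def[abs_def]
  by (simp add: l2_inner_sum_left L2_fun_cmult assms l2_inner_cmult_left)

lemma l2_inner_trig_poly_trig:
  "finite S \<Longrightarrow> l2_inner torus (trig_poly c S) (trig l) = (if l \<in> S then c l else 0)"
  by (simp add: l2_inner_trig_poly l2_inner_trig of_bool_def if_distrib[of "\<lambda>x. _ * x"]
      cong: if_cong)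

lemma norm_trig_poly:
  assumes "finite S"
  shows "(LINT x|torus. (cmod (trig_poly c S x))\<^sup>2) = (\<Sum>k\<in>S. (cmod (c k))\<^sup>2)"
proof -
  have "l2_inner torus (trig k) (trig_poly c S) = cnj (c k)" if "k \<in> S" for k
    using that assms by (subst l2_inner_commute) (simp add: l2_inner_trig_poly_trig)
  then have "l2_inner torus (trig_poly c S) (trig_poly c S) = (\<Sum>k\<in>S. c k * cnj (c k))"
    by (simp add: l2_inner_trig_poly)
  then have "complex_of_real (LINT x|torus. (cmod (trig_poly c S x))\<^sup>2)
      = of_real (\<Sum>k\<in>S. (cmod (c k))\<^sup>2)"
    by (simp add: l2_inner_self complex_norm_square flip: of_real_power)
  then show ?thesis by (simp only: of_real_eq_iff)
qed

section \<open>Fourier coefficients\<close>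

definition fourier_coeff :: "(real \<Rightarrow> complex) \<Rightarrow> int \<Rightarrow> complex" where
  "fourier_coeff g k = l2_inner torus g (trig k)"

lemma l2_inner_trig_left: "l2_inner torus (trig k) g = cnj (fourier_coeff g k)"
  unfolding fourier_coeff_def by (rule l2_inner_commute)

text \<open>Pythagoras: the partial sum of the Fourier series is the orthogonal projection of \<open>g\<close>.\<close>

lemma norm_diff_trig_poly:
  assumes "g \<in> L2_fun torus" "finite S"
  shows "(LINT x|torus. (cmod (g x - trig_poly (fourier_coeff g) S x))\<^sup>2)
    = (LINT x|torus. (cmod (g x))\<^sup>2) - (\<Sum>k\<in>S. (cmod (fourier_coeff g k))\<^sup>2)"
proof -
  let ?p = "trig_poly (fourier_coeff g) S"
  have "l2_inner torus ?p g = (\<Sum>k\<in>S. fourier_coeff g k * cnj (fourier_coeff g k))"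
    by (simp add: l2_inner_trig_poly[OF assms(1)] l2_inner_trig_left)
  also have "\<dots> = of_real (\<Sum>k\<in>S. (cmod (fourier_coeff g k))\<^sup>2)"
    by (simp add: complex_norm_square flip: of_real_power)
  finally have "l2_inner torus g ?p = of_real (\<Sum>k\<in>S. (cmod (fourier_coeff g k))\<^sup>2)"
    by (simp add: l2_inner_commute[of torus g])
  then show ?thesis
    by (simp add: l2_norm_diff assms norm_trig_poly)
qed

lemma fourier_coeff_ell2:
  assumes "g \<in> L2_fun torus"
  shows "fourier_coeff g \<in> vcarrier ell2"
proof -
  have "(\<lambda>k. (cmod (fourier_coeff g k))\<^sup>2) summable_on UNIV"
  proof (rule nonneg_bounded_partial_sums_imp_summable_on)
    show "\<forall>\<^sub>F S in finite_subsets_at_top UNIV.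
        (\<Sum>k\<in>S. (cmod (fourier_coeff g k))\<^sup>2) \<le> (LINT x|torus. (cmod (g x))\<^sup>2)"
    proof (rule eventually_finite_subsets_at_top_weakI)
      fix S :: "int set" assume "finite S"
      moreover have "0 \<le> (LINT x|torus. (cmod (g x - trig_poly (fourier_coeff g) S x))\<^sup>2)"
        by (rule integral_nonneg_AE) simp
      ultimately show "(\<Sum>k\<in>S. (cmod (fourier_coeff g k))\<^sup>2) \<le> (LINT x|torus. (cmod (g x))\<^sup>2)"
        using norm_diff_trig_poly[OF assms] by simp
    qed
  qed simp
  then show ?thesis by (simp add: ell2_def)
qed

section \<open>Convergence in the mean\<close>

text \<open>The convergence by which \<^const>\<open>fourier\<close> is defined, for a single representative \<open>g\<close>.\<close>

definition mean_limit :: "(int \<Rightarrow> complex) \<Rightarrow> (real \<Rightarrow> complex) \<Rightarrow> bool" where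
  "mean_limit c g \<longleftrightarrow>
    ((\<lambda>S. LINT x|torus. (cmod (g x - trig_poly c S x))\<^sup>2) \<longlongrightarrow> 0) (finite_subsets_at_top UNIV)"

text \<open>Convergence in the mean implies weak convergence, by the Cauchy--Schwarz inequality.\<close>

lemma mean_limit_inner:
  assumes "mean_limit c g" "g \<in> L2_fun torus" "h \<in> L2_fun torus"
  shows "((\<lambda>S. \<Sum>k\<in>S. c k * l2_inner torus (trig k) h) \<longlongrightarrow> l2_inner torus g h)
    (finite_subsets_at_top UNIV)"
proof (rule Lim_transform)
  let ?d = "\<lambda>S. LINT x|torus. (cmod (g x - trig_poly c S x))\<^sup>2"
  show "((\<lambda>S. l2_inner torus g h) \<longlongrightarrow> l2_inner torus g h) (finite_subsets_at_top UNIV)"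
    by simp
  have "((\<lambda>S. sqrt (?d S) * sqrt (LINT x|torus. (cmod (h x))\<^sup>2)) \<longlongrightarrow>
      sqrt 0 * sqrt (LINT x|torus. (cmod (h x))\<^sup>2)) (finite_subsets_at_top UNIV)"
    using assms(1) unfolding mean_limit_def
    by (rule tendsto_mult[OF tendsto_real_sqrt tendsto_const])
  then have lim: "((\<lambda>S. sqrt (?d S) * sqrt (LINT x|torus. (cmod (h x))\<^sup>2)) \<longlongrightarrow> 0)
      (finite_subsets_at_top UNIV)"
    by simp
  have "cmod ((\<Sum>k\<in>S. c k * l2_inner torus (trig k) h) - l2_inner torus g h)
      \<le> sqrt (?d S) * sqrt (LINT x|torus. (cmod (h x))\<^sup>2)" for S
    using l2_Cauchy_Schwarz[OF L2_fun_diff[OF assms(2) trig_poly_L2] assms(3)]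
    by (subst norm_minus_commute) (simp add: l2_inner_diff_left assms l2_inner_trig_poly)
  then show "((\<lambda>S. (\<Sum>k\<in>S. c k * l2_inner torus (trig k) h) - l2_inner torus g h) \<longlongrightarrow> 0)
      (finite_subsets_at_top UNIV)"
    by (intro Lim_null_comparison[OF always_eventually lim]) simp
qed

text \<open>The \<open>l\<close>-th coefficient of a partial sum over \<open>S\<close> is \<open>c l\<close> as soon as \<open>l \<in> S\<close>, so the sums with
  \<open>h = trig l\<close> are eventually constant.\<close>

lemma mean_limit_fourier_coeff:
  assumes "mean_limit c g" "g \<in> L2_fun torus"
  shows "fourier_coeff g = c"
proof
  fix l
  have "\<forall>\<^sub>F S in finite_subsets_at_top UNIV.
      (\<Sum>k\<in>S. c k * l2_inner torus (trig k) (trig l)) = c l"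
    unfolding eventually_finite_subsets_at_top
  proof (intro exI[of _ "{l}"] conjI allI impI; simp?)
    fix S assume "finite S \<and> l \<in> S"
    then show "(\<Sum>k\<in>S. c k * l2_inner torus (trig k) (trig l)) = c l"
      by (simp add: l2_inner_trig of_bool_def if_distrib[of "\<lambda>x. _ * x"] cong: if_cong)
  qed
  then have "((\<lambda>S. \<Sum>k\<in>S. c k * l2_inner torus (trig k) (trig l)) \<longlongrightarrow> c l)
      (finite_subsets_at_top UNIV)"
    by (rule tendsto_eventually)
  then show "fourier_coeff g l = c l"
    unfolding fourier_coeff_def
    by (intro tendsto_unique[OF _ mean_limit_inner[OF assms trig_L2]]) auto
qed

text \<open>Parseval's identity in polarized form.\<close>

lemma mean_limit_has_sum_inner:
  assumes "mean_limit c g" "g \<in> L2_fun torus" "h \<in> L2_fun torus"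
  shows "((\<lambda>k. c k * cnj (fourier_coeff h k)) has_sum l2_inner torus g h) UNIV"
  using mean_limit_inner[OF assms] by (simp add: has_sum_def l2_inner_trig_left)

lemma mean_limit_cong_AE:
  assumes "AE x in torus. g x = h x" "g \<in> L2_fun torus" "h \<in> L2_fun torus"
  shows "mean_limit c g \<longleftrightarrow> mean_limit c h"
proof -
  note [measurable] = assms(2,3)[THEN L2_funD(1)] L2_funD(1)[OF trig_poly_L2]
  have "(LINT x|torus. (cmod (g x - trig_poly c S x))\<^sup>2)
      = (LINT x|torus. (cmod (h x - trig_poly c S x))\<^sup>2)" for S
  proof (rule integral_cong_AE)
    show "AE x in torus. (cmod (g x - trig_poly c S x))\<^sup>2 = (cmod (h x - trig_poly c S x))\<^sup>2"
      using assms(1) by eventually_elim simp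
  qed measurable
  then show ?thesis by (simp add: mean_limit_def)
qed

section \<open>The Riesz--Fischer theorem\<close>

lemma one_L2_torus: "(\<lambda>x. 1 :: complex) \<in> L2_fun torus"
  by (simp add: L2_fun_def)

lemma L2_torus_integrable: "g \<in> L2_fun torus \<Longrightarrow> integrable torus g" for g :: "real \<Rightarrow> complex"
  using integrable_mult_cnj[OF _ one_L2_torus] by simp

lemma torus_L1_le_L2:
  assumes "g \<in> L2_fun torus"
  shows "(LINT x|torus. cmod (g x)) \<le> sqrt (LINT x|torus. (cmod (g x))\<^sup>2)"
  using l2_Cauchy_Schwarz_real[OF assms one_L2_torus]
  by (intro real_le_rsqrt) (simp add: measure_torus)

lemma filterlim_symmetric_intervals:
  "filterlim (\<lambda>n. {- int n..int n}) (finite_subsets_at_top UNIV) sequentially"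
  unfolding filterlim_finite_subsets_at_top
proof (intro allI impI)
  fix A :: "int set" assume A: "finite A \<and> A \<subseteq> UNIV"
  then have "finite ((\<lambda>k. nat \<bar>k\<bar>) ` A)" by simp
  then obtain N where N: "\<And>k. k \<in> A \<Longrightarrow> nat \<bar>k\<bar> \<le> N"
    by (meson finite_nat_set_iff_bounded_le imageI)
  have "A \<subseteq> {- int n..int n}" if "N \<le> n" for n
  proof
    fix k assume "k \<in> A"
    then show "k \<in> {- int n..int n}" using N[of k] that by auto
  qed
  then show "\<forall>\<^sub>F n in sequentially. finite {- int n..int n} \<and> A \<subseteq> {- int n..int n}
      \<and> {- int n..int n} \<subseteq> UNIV"
    by (auto simp: eventually_sequentially)
qed

text \<open>Two partial sums are compared through the partial sum over \<open>S \<union> T\<close>: there each difference is a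
  trigonometric polynomial with coefficients outside \<open>S\<close> or \<open>T\<close>, whose norm is a tail of the series.\<close>

lemma norm_diff_trig_polys:
  assumes "finite S" "finite T"
    and le: "\<And>R. finite R \<Longrightarrow> (\<Sum>k\<in>R. (cmod (c k))\<^sup>2) \<le> C"
  shows "(LINT x|torus. (cmod (trig_poly c S x - trig_poly c T x))\<^sup>2)
    \<le> 2 * (C - (\<Sum>k\<in>S. (cmod (c k))\<^sup>2)) + 2 * (C - (\<Sum>k\<in>T. (cmod (c k))\<^sup>2))"
proof -
  have sub: "(LINT x|torus. (cmod (trig_poly c (S \<union> T) x - trig_poly c A x))\<^sup>2)
      \<le> C - (\<Sum>k\<in>A. (cmod (c k))\<^sup>2)" if "A \<subseteq> S \<union> T" for A
  proof -
    have "trig_poly c (S \<union> T) x - trig_poly c A x = trig_poly c (S \<union> T - A) x" for x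
      unfolding trig_poly_def using assms(1,2) that by (simp add: sum_diff)
    then have "(LINT x|torus. (cmod (trig_poly c (S \<union> T) x - trig_poly c A x))\<^sup>2)
        = (\<Sum>k\<in>S \<union> T - A. (cmod (c k))\<^sup>2)"
      using norm_trig_poly[of "S \<union> T - A" c] assms(1,2) by simp
    also have "\<dots> = (\<Sum>k\<in>S \<union> T. (cmod (c k))\<^sup>2) - (\<Sum>k\<in>A. (cmod (c k))\<^sup>2)"
      using assms(1,2) that by (simp add: sum_diff)
    also have "\<dots> \<le> C - (\<Sum>k\<in>A. (cmod (c k))\<^sup>2)"
      using le[of "S \<union> T"] assms(1,2) by simp
    finally show ?thesis .
  qed
  have "(LINT x|torus. (cmod (trig_poly c S x - trig_poly c T x))\<^sup>2)
      \<le> 2 * (LINT x|torus. (cmod (trig_poly c S x - trig_poly c (S \<union> T) x))\<^sup>2)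
        + 2 * (LINT x|torus. (cmod (trig_poly c (S \<union> T) x - trig_poly c T x))\<^sup>2)"
    by (rule l2_triangle_diff) auto
  also have "(LINT x|torus. (cmod (trig_poly c S x - trig_poly c (S \<union> T) x))\<^sup>2)
      = (LINT x|torus. (cmod (trig_poly c (S \<union> T) x - trig_poly c S x))\<^sup>2)"
    by (simp only: norm_minus_commute)
  finally show ?thesis using sub[of S] sub[of T] by simp
qed

text \<open>The symmetric partial sums form a Cauchy sequence in the mean, hence also in \<open>L\<^sup>1\<close> since the torus has
  measure 1. A subsequence therefore converges almost everywhere, and its pointwise limit is the
  desired function.\<close>

theorem Riesz_Fischer:
  assumes "c \<in> vcarrier ell2"
  obtains g where "g \<in> L2_fun torus" "mean_limit c g"
proof -
  define C where "C = (\<Sum>\<^sub>\<infinity>k. (cmod (c k))\<^sup>2)"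
  define tail where "tail S = C - (\<Sum>k\<in>S. (cmod (c k))\<^sup>2)" for S
  have summ: "(\<lambda>k. (cmod (c k))\<^sup>2) summable_on UNIV"
    using assms by (simp add: ell2_def)
  have le: "(\<Sum>k\<in>R. (cmod (c k))\<^sup>2) \<le> C" if "finite R" for R
    unfolding C_def using summ that by (intro finite_sum_le_infsum) auto
  have "((\<lambda>S. \<Sum>k\<in>S. (cmod (c k))\<^sup>2) \<longlongrightarrow> C) (finite_subsets_at_top UNIV)"
    using has_sum_infsum[OF summ] by (simp add: has_sum_def C_def)
  then have "((\<lambda>S. C - (\<Sum>k\<in>S. (cmod (c k))\<^sup>2)) \<longlongrightarrow> C - C) (finite_subsets_at_top UNIV)"
    by (rule tendsto_diff[OF tendsto_const])
  then have tail: "(tail \<longlongrightarrow> 0) (finite_subsets_at_top UNIV)"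
    by (simp add: tail_def[abs_def])
  have dist: "(LINT x|torus. (cmod (trig_poly c S x - trig_poly c T x))\<^sup>2) \<le> 2 * tail S + 2 * tail T"
    if "finite S" "finite T" for S T
    unfolding tail_def by (rule norm_diff_trig_polys[OF that le])
  have tail_nonneg: "0 \<le> tail S" if "finite S" for S
    using le[OF that] by (simp add: tail_def)

  define s where "s n = trig_poly c {- int n..int n}" for n
  define t where "t n = tail {- int n..int n}" for n
  have s_L2 [simp]: "s n \<in> L2_fun torus" for n by (simp add: s_def)
  note [measurable] = L2_funD(1)[OF s_L2] L2_funD(1)[OF trig_poly_L2]
  have t: "t \<longlonglongrightarrow> 0"
    unfolding t_def using filterlim_compose[OF tail filterlim_symmetric_intervals] .
  obtain r where r: "strict_mono r" "AE x in torus. Cauchy (\<lambda>i. s (r i) x)"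
  proof (rule cauchy_L1_AE_cauchy_subseq)
    show "integrable torus (s n)" for n by (rule L2_torus_integrable[OF s_L2])
    fix e :: real assume "0 < e"
    then have "\<forall>\<^sub>F n in sequentially. t n < e\<^sup>2 / 4"
      by (intro order_tendstoD(2)[OF t]) simp
    then obtain N where N: "\<And>n. N \<le> n \<Longrightarrow> t n < e\<^sup>2 / 4"
      by (auto simp: eventually_sequentially)
    \<comment> \<open>The threshold for \<open>t\<close> makes the squared distance \<open>2 * t i + 2 * t j\<close> less than \<open>e\<^sup>2\<close>.\<close>
    have "(LINT x|torus. cmod (s i x - s j x)) < e" if "N \<le> i" "N \<le> j" for i j
    proof -
      have "(LINT x|torus. cmod (s i x - s j x)) \<le> sqrt (LINT x|torus. (cmod (s i x - s j x))\<^sup>2)"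
        by (intro torus_L1_le_L2 L2_fun_diff s_L2)
      also have "\<dots> \<le> sqrt (2 * t i + 2 * t j)"
        unfolding s_def t_def by (intro real_sqrt_le_mono dist) auto
      also have "\<dots> < sqrt (e\<^sup>2)"
        using N[OF that(1)] N[OF that(2)] by (intro real_sqrt_less_mono) linarith
      finally show ?thesis using \<open>0 < e\<close> by simp
    qed
    then show "\<exists>N. \<forall>i\<ge>N. \<forall>j\<ge>N. (LINT x|torus. cmod (s i x - s j x)) < e" by blast
  qed
  define g where "g x = lim (\<lambda>i. s (r i) x)" for x
  have [measurable]: "g \<in> borel_measurable torus" unfolding g_def by measurable
  have g: "AE x in torus. (\<lambda>i. s (r i) x) \<longlonglongrightarrow> g x"
    using r(2) unfolding g_def by eventually_elim (simp add: Cauchy_convergent_iff convergent_LIMSEQ_iff)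
  have tr: "(\<lambda>i. t (r i)) \<longlonglongrightarrow> 0"
    using LIMSEQ_subseq_LIMSEQ[OF t r(1)] by (simp add: o_def)

  \<comment> \<open>Fatou's lemma along the subsequence bounds the distance of the limit to any partial sum.\<close>
  have bound: "(\<integral>\<^sup>+x. ennreal ((cmod (g x - trig_poly c S x))\<^sup>2) \<partial>torus) \<le> ennreal (2 * tail S)"
    if S: "finite S" for S
  proof -
    have "(\<integral>\<^sup>+x. ennreal ((cmod (g x - trig_poly c S x))\<^sup>2) \<partial>torus)
        = (\<integral>\<^sup>+x. liminf (\<lambda>i. ennreal ((cmod (s (r i) x - trig_poly c S x))\<^sup>2)) \<partial>torus)"
    proof (rule nn_integral_cong_AE)
      show "AE x in torus. ennreal ((cmod (g x - trig_poly c S x))\<^sup>2)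
          = liminf (\<lambda>i. ennreal ((cmod (s (r i) x - trig_poly c S x))\<^sup>2))"
        using g
      proof eventually_elim
        case (elim x)
        then have "(\<lambda>i. ennreal ((cmod (s (r i) x - trig_poly c S x))\<^sup>2))
            \<longlonglongrightarrow> ennreal ((cmod (g x - trig_poly c S x))\<^sup>2)"
          by (intro tendsto_ennrealI tendsto_power tendsto_norm tendsto_diff tendsto_const)
        then show ?case by (rule lim_imp_Liminf[OF sequentially_bot, symmetric])
      qed
    qed
    also have "\<dots> \<le> liminf (\<lambda>i. \<integral>\<^sup>+x. ennreal ((cmod (s (r i) x - trig_poly c S x))\<^sup>2) \<partial>torus)"
      by (rule nn_integral_liminf) measurable
    also have "\<dots> \<le> liminf (\<lambda>i. ennreal (2 * t (r i) + 2 * tail S))"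
    proof (intro Liminf_mono always_eventually allI)
      fix i
      have "(\<integral>\<^sup>+x. ennreal ((cmod (s (r i) x - trig_poly c S x))\<^sup>2) \<partial>torus)
          = ennreal (LINT x|torus. (cmod (s (r i) x - trig_poly c S x))\<^sup>2)"
        by (intro nn_integral_eq_integral L2_funD(2) L2_fun_diff s_L2 trig_poly_L2) simp
      also have "\<dots> \<le> ennreal (2 * t (r i) + 2 * tail S)"
        unfolding s_def t_def by (intro ennreal_leI dist S) simp
      finally show "(\<integral>\<^sup>+x. ennreal ((cmod (s (r i) x - trig_poly c S x))\<^sup>2) \<partial>torus)
          \<le> ennreal (2 * t (r i) + 2 * tail S)" .
    qed
    also have "\<dots> = ennreal (2 * tail S)"
    proof -
      have "(\<lambda>i. 2 * t (r i) + 2 * tail S) \<longlonglongrightarrow> 2 * 0 + 2 * tail S"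
        by (intro tendsto_add tendsto_mult tendsto_const tr)
      then have "(\<lambda>i. ennreal (2 * t (r i) + 2 * tail S)) \<longlonglongrightarrow> ennreal (2 * tail S)"
        by (intro tendsto_ennrealI) simp
      then show ?thesis by (simp add: lim_imp_Liminf)
    qed
    finally show ?thesis .
  qed
  \<comment> \<open>For the empty partial sum this bounds \<open>g\<close> itself.\<close>
  have "(\<lambda>x. g x - trig_poly c {} x) \<in> L2_fun torus"
    using bound[of "{}"]
    by (auto simp: L2_fun_def integrable_iff_bounded top.not_eq_extremum
        intro!: le_less_trans[OF _ ennreal_less_top])
  then have g_L2: "g \<in> L2_fun torus" by (simp add: trig_poly_def)
  have "mean_limit c g"
    unfolding mean_limit_def
  proof (rule tendsto_sandwich[OF _ _ tendsto_const])
    show "((\<lambda>S. 2 * tail S) \<longlongrightarrow> 0) (finite_subsets_at_top UNIV)"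
      using tendsto_mult[OF tendsto_const[of 2] tail] by simp
    show "\<forall>\<^sub>F S in finite_subsets_at_top UNIV. 0 \<le> (LINT x|torus. (cmod (g x - trig_poly c S x))\<^sup>2)"
      by (intro always_eventually allI integral_nonneg_AE) simp
    show "\<forall>\<^sub>F S in finite_subsets_at_top UNIV.
        (LINT x|torus. (cmod (g x - trig_poly c S x))\<^sup>2) \<le> 2 * tail S"
    proof (rule eventually_finite_subsets_at_top_weakI)
      fix S :: "int set" assume S: "finite S"
      have "ennreal (LINT x|torus. (cmod (g x - trig_poly c S x))\<^sup>2)
          = (\<integral>\<^sup>+x. ennreal ((cmod (g x - trig_poly c S x))\<^sup>2) \<partial>torus)"
        by (intro nn_integral_eq_integral[symmetric] L2_funD(2) L2_fun_diff g_L2 trig_poly_L2) simp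
      also have "\<dots> \<le> ennreal (2 * tail S)" by (rule bound[OF S])
      finally show "(LINT x|torus. (cmod (g x - trig_poly c S x))\<^sup>2) \<le> 2 * tail S"
        using tail_nonneg[OF S] by simp
    qed
  qed
  with g_L2 show ?thesis by (rule that)
qed

section \<open>Completeness of the trigonometric system\<close>

definition circle_pt :: "real \<Rightarrow> complex" where
  "circle_pt x = cis (2 * pi * x)"

text \<open>All Fourier coefficients of \<open>h\<close> vanish: the conjugate of a character is again a character.\<close>

definition fourier_null :: "(real \<Rightarrow> complex) set" where
  "fourier_null = {h. integrable torus h \<and> (\<forall>k. (LINT x|torus. trig k x * h x) = 0)}"

lemma integrable_bounded_mult:
  fixes h :: "'a \<Rightarrow> complex"
  assumes "integrable M h" "c \<in> borel_measurable M" "\<And>x. cmod (c x) \<le> B"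
  shows "integrable M (\<lambda>x. c x * h x)"
proof (rule Bochner_Integration.integrable_bound)
  show "integrable M (\<lambda>x. B * cmod (h x))" using assms(1) by simp
  show "(\<lambda>x. c x * h x) \<in> borel_measurable M"
    using assms(1,2) by (intro borel_measurable_times) auto
  show "AE x in M. norm (c x * h x) \<le> norm (B * cmod (h x))"
  proof (intro AE_I2)
    fix x
    have "norm (c x * h x) \<le> B * cmod (h x)"
      unfolding norm_mult by (intro mult_right_mono assms(3)) auto
    also have "\<dots> \<le> norm (B * cmod (h x))" by simp
    finally show "norm (c x * h x) \<le> norm (B * cmod (h x))" .
  qed
qed

lemma integrable_trig_mult: "integrable torus h \<Longrightarrow> integrable torus (\<lambda>x. trig k x * h x)"
  by (rule integrable_bounded_mult[of _ _ _ 1]) auto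

lemma fourier_null_add:
  "g \<in> fourier_null \<Longrightarrow> h \<in> fourier_null \<Longrightarrow> (\<lambda>x. g x + h x) \<in> fourier_null"
  by (simp add: fourier_null_def ring_distribs integrable_trig_mult)

lemma fourier_null_cmult: "h \<in> fourier_null \<Longrightarrow> (\<lambda>x. c * h x) \<in> fourier_null"
  by (simp add: fourier_null_def mult.left_commute)

lemma fourier_null_trig: "h \<in> fourier_null \<Longrightarrow> (\<lambda>x. trig l x * h x) \<in> fourier_null"
  by (simp add: fourier_null_def integrable_trig_mult trig_mult flip: mult.assoc)

lemma continuous_circle_pt: "continuous_on UNIV circle_pt"
  unfolding circle_pt_def cis_conv_exp by (intro continuous_intros)

lemma circle_pt_sphere: "circle_pt x \<in> sphere 0 1"
  by (simp add: circle_pt_def)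

lemma continuous_on_circle_pt_compose:
  fixes u :: "complex \<Rightarrow> real"
  assumes "continuous_on (sphere 0 1) u"
  shows "(\<lambda>x. u (circle_pt x)) \<in> borel_measurable torus" "\<exists>B. \<forall>x. \<bar>u (circle_pt x)\<bar> \<le> B"
proof -
  have "continuous_on UNIV (\<lambda>x. u (circle_pt x))"
    by (rule continuous_on_compose2[OF assms continuous_circle_pt]) (use circle_pt_sphere in auto)
  then show "(\<lambda>x. u (circle_pt x)) \<in> borel_measurable torus"
    by (intro measurable_torusI borel_measurable_continuous_onI)
  have "bounded (u ` sphere 0 1)"
    by (intro compact_imp_bounded compact_continuous_image assms compact_sphere)
  then obtain B where "\<And>z. z \<in> sphere 0 1 \<Longrightarrow> \<bar>u z\<bar> \<le> B"
    unfolding bounded_iff by (metis imageI real_norm_def)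
  then show "\<exists>B. \<forall>x. \<bar>u (circle_pt x)\<bar> \<le> B"
    using circle_pt_sphere by blast
qed

lemma integrable_circle_mult:
  fixes h :: "real \<Rightarrow> complex"
  assumes "continuous_on (sphere 0 1) u" "integrable torus h"
  shows "integrable torus (\<lambda>x. of_real (u (circle_pt x)) * h x)"
proof -
  note [measurable] = continuous_on_circle_pt_compose(1)[OF assms(1)]
  obtain B where "\<And>x. \<bar>u (circle_pt x)\<bar> \<le> B"
    using continuous_on_circle_pt_compose(2)[OF assms(1)] by blast
  then show ?thesis
    by (intro integrable_bounded_mult[OF assms(2), of _ B]) auto
qed

text \<open>Instead of describing trigonometric polynomials as an algebra of functions on the circle, take all
  continuous \<open>v\<close> such that multiplication by \<open>v\<close> preserves \<^const>\<open>fourier_null\<close>. Closure under products is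
  then immediate, and the two coordinate functions belong to it because multiplication by a
  character only shifts Fourier coefficients.\<close>

lemma fourier_null_Stone_Weierstrass:
  assumes u: "continuous_on (sphere 0 1) u" and "0 < e"
  shows "\<exists>v. (continuous_on (sphere 0 1) v
      \<and> (\<forall>h\<in>fourier_null. (\<lambda>x. of_real (v (circle_pt x)) * h x) \<in> fourier_null))
    \<and> (\<forall>z\<in>sphere 0 1. \<bar>u z - v z\<bar> < e)"
proof (rule Stone_Weierstrass_HOL[OF compact_sphere _ _ _ _ _ u \<open>0 < e\<close>])
  let ?P = "\<lambda>v. continuous_on (sphere 0 1) v
      \<and> (\<forall>h\<in>fourier_null. (\<lambda>x. of_real (v (circle_pt x)) * h x) \<in> fourier_null)"
  show "?P (\<lambda>z. c)" for c
    by (auto intro: fourier_null_cmult)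
  show "continuous_on (sphere 0 1) v" if "?P v" for v
    using that by blast
  show "?P (\<lambda>z. v z + w z)" if "?P v \<and> ?P w" for v w
    using that by (auto simp: ring_distribs intro!: fourier_null_add continuous_on_add)
  show "?P (\<lambda>z. v z * w z)" if "?P v \<and> ?P w" for v w
    using that by (auto simp: mult.assoc intro!: continuous_on_mult)
  have Re: "complex_of_real (Re (circle_pt x)) = 1/2 * (trig 1 x + trig (- 1) x)" for x
    by (simp add: circle_pt_def trig_cis complex_eq_iff)
  have Im: "complex_of_real (Im (circle_pt x)) = - (\<i> / 2) * (trig 1 x + (- 1) * trig (- 1) x)" for x
    by (simp add: circle_pt_def trig_cis complex_eq_iff)
  have "(\<lambda>x. of_real (Re (circle_pt x)) * h x) \<in> fourier_null" if h: "h \<in> fourier_null" for h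
    using fourier_null_cmult[OF fourier_null_add[OF fourier_null_trig[OF h, of 1]
          fourier_null_trig[OF h, of "- 1"]], of "1/2"]
    unfolding Re by (simp only: mult.assoc distrib_right)
  then have 1: "?P Re" by (auto intro: continuous_on_Re continuous_on_id)
  have "(\<lambda>x. of_real (Im (circle_pt x)) * h x) \<in> fourier_null" if h: "h \<in> fourier_null" for h
    using fourier_null_cmult[OF fourier_null_add[OF fourier_null_trig[OF h, of 1]
          fourier_null_cmult[OF fourier_null_trig[OF h, of "- 1"], of "- 1"]], of "- (\<i> / 2)"]
    unfolding Im by (simp only: mult.assoc distrib_right)
  then have 2: "?P Im" by (auto intro: continuous_on_Im continuous_on_id)
  show "\<exists>v. ?P v \<and> v z \<noteq> v w" if "z \<in> sphere 0 1 \<and> w \<in> sphere 0 1 \<and> z \<noteq> w" for z w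
    using that complex_eqI[of z w] 1 2 by blast
qed

text \<open>A multiplier of \<^const>\<open>fourier_null\<close> integrates \<open>h\<close> to zero, by the coefficient at 0 of the product,
  and \<open>u\<close> is a uniform limit of multipliers.\<close>

lemma fourier_null_continuous:
  assumes h: "h \<in> fourier_null" and u: "continuous_on (sphere 0 1) u"
  shows "(LINT x|torus. of_real (u (circle_pt x)) * h x) = 0"
proof -
  define I where "I = (LINT x|torus. of_real (u (circle_pt x)) * h x)"
  define L where "L = (LINT x|torus. cmod (h x))"
  have int: "integrable torus h" using h by (simp add: fourier_null_def)
  have "0 \<le> L" unfolding L_def by (rule integral_nonneg_AE) simp
  have bound: "cmod I \<le> e * L" if e: "0 < e" for e
  proof -
    obtain v where v: "continuous_on (sphere 0 1) v"
      "(\<lambda>x. of_real (v (circle_pt x)) * h x) \<in> fourier_null"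
      "\<And>z. z \<in> sphere 0 1 \<Longrightarrow> \<bar>u z - v z\<bar> < e"
      using fourier_null_Stone_Weierstrass[OF u e] h by blast
    have "(LINT x|torus. trig 0 x * (of_real (v (circle_pt x)) * h x)) = 0"
      using v(2) unfolding fourier_null_def by blast
    then have "I = (LINT x|torus. of_real (u (circle_pt x)) * h x - of_real (v (circle_pt x)) * h x)"
      unfolding I_def
      by (subst Bochner_Integration.integral_diff[OF integrable_circle_mult[OF u int]
            integrable_circle_mult[OF v(1) int]]) simp
    also have "cmod \<dots> \<le> (LINT x|torus. e * cmod (h x))"
    proof (rule Bochner_Integration.integral_norm_bound_integral)
      show "norm (complex_of_real (u (circle_pt x)) * h x - of_real (v (circle_pt x)) * h x)
          \<le> e * cmod (h x)" for x
        unfolding left_diff_distrib[symmetric] of_real_diff[symmetric] norm_mult norm_of_real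
        by (rule mult_right_mono[OF less_imp_le[OF v(3)[OF circle_pt_sphere]] norm_ge_zero])
      show "integrable torus (\<lambda>x. complex_of_real (u (circle_pt x)) * h x - of_real (v (circle_pt x)) * h x)"
        by (intro Bochner_Integration.integrable_diff integrable_circle_mult u v(1) int)
    qed (use int in simp)
    finally show ?thesis by (simp add: L_def)
  qed
  have "cmod I \<le> 0"
  proof (rule ccontr)
    assume "\<not> cmod I \<le> 0"
    then have I: "0 < cmod I" by simp
    \<comment> \<open>Dividing by \<open>L + 1\<close> rather than \<open>L\<close> also covers \<open>L = 0\<close>.\<close>
    have "cmod I \<le> cmod I / (L + 1) * L"
      using \<open>0 \<le> L\<close> I by (intro bound) simp
    then have "cmod I * (L + 1) \<le> cmod I * L"
      using \<open>0 \<le> L\<close> by (simp add: field_simps)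
    then show False using I by (simp add: ring_distribs)
  qed
  then show ?thesis by (simp add: I_def)
qed

lemma circle_pt_inj:
  assumes "circle_pt x = circle_pt y" "\<bar>x - y\<bar> < 1"
  shows "x = y"
proof -
  have "sin (2 * pi * x) = sin (2 * pi * y) \<and> cos (2 * pi * x) = cos (2 * pi * y)"
    using assms(1) by (simp add: circle_pt_def complex_eq_iff)
  then obtain n :: int where "2 * pi * x = 2 * pi * y + 2 * pi * n"
    unfolding sin_cos_eq_iff by blast
  then have "2 * pi * (x - y - n) = 0" by (simp add: algebra_simps)
  then have n: "x - y = of_int n" by simp
  with assms(2) have "n = 0" by linarith
  with n show ?thesis by simp
qed

text \<open>The indicator of a compact subset \<open>K\<close> of the circle is the pointwise limit of the continuous functions
  \<open>max 0 (1 - n * infdist z K)\<close>. For \<open>K\<close> take the image of the part of \<open>F\<close> in the closed interval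
  \<open>[-1/2, 1/2]\<close>; membership in \<open>K\<close> and in \<open>F\<close> can differ on the torus only at \<open>-1/2\<close>, which is
  identified with \<open>1/2\<close>.\<close>

lemma fourier_null_closed:
  assumes h: "h \<in> fourier_null" and F: "closed F"
  shows "(LINT x:F \<inter> space torus|torus. h x) = 0"
proof (cases "F \<inter> {-1/2..1/2} = {}")
  case True
  then have "F \<inter> space torus = {}" by (force simp: space_torus)
  then show ?thesis by (simp add: set_lebesgue_integral_def)
next
  case False
  define K where "K = circle_pt ` (F \<inter> {-1/2..1/2})"
  define u where "u n z = max 0 (1 - real n * infdist z K)" for n z
  have int: "integrable torus h" using h by (simp add: fourier_null_def)
  have "compact K"
    unfolding K_def using F
    by (intro compact_continuous_image continuous_on_subset[OF continuous_circle_pt]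
        closed_Int_compact) auto
  then have K: "closed K" "K \<noteq> {}" using False by (auto simp: K_def compact_imp_closed)
  have cont: "continuous_on (sphere 0 1) (u n)" for n
    unfolding u_def by (intro continuous_intros)
  have lim: "(\<lambda>n. u n z) \<longlonglongrightarrow> indicator K z" for z
  proof (cases "z \<in> K")
    case True
    then show ?thesis by (simp add: u_def)
  next
    case False
    then have pos: "0 < infdist z K"
      using in_closed_iff_infdist_zero[OF K] infdist_nonneg[of z K] by (simp add: less_le)
    obtain N where N: "1 / infdist z K < real N" using reals_Archimedean2 by blast
    have "u n z = 0" if "N \<le> n" for n
    proof -
      have "1 / infdist z K < real n" using N that by simp
      then show ?thesis using pos by (simp add: u_def field_simps)
    qed
    then have "\<forall>\<^sub>F n in sequentially. u n z = 0" by (auto simp: eventually_sequentially)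
    then show ?thesis using False by (simp add: tendsto_eventually)
  qed
  have "(\<lambda>n. LINT x|torus. of_real (u n (circle_pt x)) * h x)
      \<longlonglongrightarrow> (LINT x|torus. indicator (F \<inter> space torus) x *\<^sub>R h x)"
  proof (rule integral_dominated_convergence[where w = "\<lambda>x. cmod (h x)"])
    have [measurable]: "h \<in> borel_measurable torus" using int by auto
    have "F \<inter> space torus \<in> sets torus"
      using F by (auto simp: sets_torus space_torus sets_restrict_space)
    then show "(\<lambda>x. indicator (F \<inter> space torus) x *\<^sub>R h x) \<in> borel_measurable torus"
      by measurable
    show "(\<lambda>x. of_real (u n (circle_pt x)) * h x) \<in> borel_measurable torus" for n
      using integrable_circle_mult[OF cont int] by auto
    show "integrable torus (\<lambda>x. cmod (h x))" using int by simp
    show "AE x in torus. norm (of_real (u n (circle_pt x)) * h x) \<le> cmod (h x)" for n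
    proof (intro AE_I2)
      fix x
      have "\<bar>u n (circle_pt x)\<bar> * cmod (h x) \<le> 1 * cmod (h x)"
        by (intro mult_right_mono) (auto simp: u_def infdist_nonneg)
      then show "norm (of_real (u n (circle_pt x)) * h x) \<le> cmod (h x)"
        by (simp add: norm_mult)
    qed
    have "AE x in lborel. x \<noteq> (- 1/2 :: real)" by (rule AE_lborel_singleton)
    then have "AE x in torus. x \<noteq> - 1/2" by (intro AE_torusI) auto
    then show "AE x in torus. (\<lambda>n. of_real (u n (circle_pt x)) * h x)
        \<longlonglongrightarrow> indicator (F \<inter> space torus) x *\<^sub>R h x"
      using AE_space
    proof eventually_elim
      case (elim x)
      have "circle_pt x \<in> K \<longleftrightarrow> x \<in> F"
      proof
        assume "circle_pt x \<in> K"
        then obtain y where y: "y \<in> F" "y \<in> {-1/2..1/2}" "circle_pt x = circle_pt y"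
          by (auto simp: K_def)
        then have "x = y" using elim by (intro circle_pt_inj) (auto simp: space_torus)
        then show "x \<in> F" using y by simp
      qed (use elim in \<open>auto simp: K_def space_torus\<close>)
      then have "indicator (F \<inter> space torus) x = (indicator K (circle_pt x) :: real)"
        using elim by (simp add: indicator_def)
      moreover have "(\<lambda>n. complex_of_real (u n (circle_pt x)) * h x)
          \<longlonglongrightarrow> complex_of_real (indicator K (circle_pt x)) * h x"
        by (intro tendsto_mult tendsto_of_real lim tendsto_const)
      ultimately show ?case by (simp add: scaleR_conv_of_real)
    qed
  qed
  then have "(LINT x|torus. indicator (F \<inter> space torus) x *\<^sub>R h x) = 0"
    using LIMSEQ_unique[OF _ tendsto_const[of 0]]
    by (simp add: fourier_null_continuous[OF h cont])
  then show ?thesis by (simp add: set_lebesgue_integral_def)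
qed

text \<open>The sets over which \<open>h\<close> integrates to zero form a Dynkin system only; the closed sets are a generator
  of the Borel sets that is stable under intersection.\<close>

lemma fourier_null_borel:
  assumes h: "h \<in> fourier_null" and B: "B \<in> sigma_sets UNIV (Collect closed)"
  shows "(LINT x:B \<inter> space torus|torus. h x) = 0"
proof -
  have int: "integrable torus h" using h by (simp add: fourier_null_def)
  have sets: "A \<inter> space torus \<in> sets torus" if "A \<in> sigma_sets UNIV (Collect closed)" for A
  proof -
    have "A \<in> sets borel" using that by (simp add: borel_eq_closed)
    then show ?thesis by (auto simp: sets_torus space_torus sets_restrict_space)
  qed
  have set_int: "set_integrable torus A h" if "A \<in> sets torus" for A
    unfolding set_integrable_def by (rule integrable_mult_indicator[OF that int])
  have "Int_stable (Collect closed :: real set set)" "(Collect closed :: real set set) \<subseteq> Pow UNIV"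
    by (auto simp: Int_stable_def)
  then show ?thesis
    using B
  proof (induction rule: sigma_sets_induct_disjoint)
    case (compl A)
    have "space torus = A \<inter> space torus \<union> (UNIV - A) \<inter> space torus" by auto
    then have "(LINT x:space torus|torus. h x)
        = (LINT x:A \<inter> space torus \<union> (UNIV - A) \<inter> space torus|torus. h x)" by simp
    also have "\<dots> = (LINT x:A \<inter> space torus|torus. h x)
        + (LINT x:(UNIV - A) \<inter> space torus|torus. h x)"
      using compl.hyps
      by (intro set_integral_Un set_int sets) (auto intro: sigma_sets.Compl)
    finally show ?case
      using compl.IH fourier_null_closed[OF h closed_UNIV] by simp
  next
    case (union A)
    have "(LINT x:(\<Union>i. A i \<inter> space torus)|torus. h x)
        = (\<Sum>i. LINT x:A i \<inter> space torus|torus. h x)"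
    proof (rule lebesgue_integral_countable_add)
      show 1: "A i \<inter> space torus \<in> sets torus" for i
        using union.hyps by (intro sets) auto
      show "A i \<inter> space torus \<inter> (A j \<inter> space torus) = {}" if "i \<noteq> j" for i j
        using union.hyps that by (auto simp: disjoint_family_on_def)
      show "set_integrable torus (\<Union>i. A i \<inter> space torus) h"
        by (intro set_int sets.countable_UN) (use 1 in auto)
    qed
    then show ?case using union.IH by simp
  qed (use fourier_null_closed[OF h] in \<open>auto simp: set_lebesgue_integral_def\<close>)
qed

text \<open>An integrable function whose integral over every measurable set vanishes is zero almost
  everywhere; this is applied to \<open>g - h\<close>.\<close>

theorem fourier_coeff_unique:
  assumes "g \<in> L2_fun torus" "h \<in> L2_fun torus" "fourier_coeff g = fourier_coeff h"
  shows "AE x in torus. g x = h x"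
proof -
  let ?d = "\<lambda>x. g x - h x"
  have d: "?d \<in> L2_fun torus" by (rule L2_fun_diff[OF assms(1,2)])
  have "(LINT x|torus. trig k x * ?d x) = 0" for k
  proof -
    have "(LINT x|torus. trig k x * ?d x) = l2_inner torus ?d (trig (- k))"
      by (simp add: l2_inner_def cnj_trig mult.commute)
    also have "\<dots> = fourier_coeff g (- k) - fourier_coeff h (- k)"
      by (simp add: l2_inner_diff_left assms(1,2) fourier_coeff_def)
    finally show ?thesis using assms(3) by simp
  qed
  then have null: "?d \<in> fourier_null"
    using L2_torus_integrable[OF d] by (simp add: fourier_null_def)
  have "AE x in torus. ?d x = 0"
  proof (rule torus.density_zero[OF L2_torus_integrable[OF d]])
    fix A assume "A \<in> sets torus"
    then obtain B where "B \<in> sets borel" "A = B \<inter> space torus"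
      by (auto simp: sets_torus space_torus sets_restrict_space)
    then show "(LINT x:A|torus. ?d x) = 0"
      using fourier_null_borel[OF null, of B] by (simp add: borel_eq_closed)
  qed
  then show ?thesis by eventually_elim simp
qed

section \<open>The Fourier transform is unitary\<close>

lemma ell2_fourier_coeff:
  assumes "c \<in> vcarrier ell2"
  obtains g where "g \<in> L2_fun torus" "fourier_coeff g = c"
  using Riesz_Fischer[OF assms] mean_limit_fourier_coeff by metis

lemma mean_limit_fourier_series:
  assumes "g \<in> L2_fun torus"
  shows "mean_limit (fourier_coeff g) g"
proof -
  obtain h where h: "h \<in> L2_fun torus" "mean_limit (fourier_coeff g) h"
    using Riesz_Fischer[OF fourier_coeff_ell2[OF assms]] by blast
  have "AE x in torus. h x = g x"
    by (rule fourier_coeff_unique[OF h(1) assms mean_limit_fourier_coeff[OF h(2,1)]])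
  then show ?thesis using mean_limit_cong_AE[OF _ h(1) assms] h(2) by blast
qed

text \<open>The description in \<^const>\<open>fourier\<close> is met by the class of \<open>g\<close>, and by no other class, since a limit in
  the mean has the prescribed coefficients and these determine it.\<close>

lemma fourier_fourier_coeff:
  assumes g: "g \<in> L2_fun torus"
  shows "fourier (fourier_coeff g) = ae_class torus g"
proof -
  have "fourier (fourier_coeff g)
      = (THE G. G \<in> vcarrier L2T \<and> (\<forall>g'\<in>G. mean_limit (fourier_coeff g) g'))"
    by (simp add: fourier_def mean_limit_def trig_poly_def trig_def)
  also have "\<dots> = ae_class torus g"
  proof (rule the_equality)
    have "mean_limit (fourier_coeff g) g'" if "g' \<in> ae_class torus g" for g'
    proof -
      have "g' \<in> L2_fun torus" "AE x in torus. g x = g' x"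
        using that by (auto simp: ae_class_def)
      then show ?thesis
        using mean_limit_cong_AE[OF _ g] mean_limit_fourier_series[OF g] by blast
    qed
    then show "ae_class torus g \<in> vcarrier L2T
        \<and> (\<forall>g'\<in>ae_class torus g. mean_limit (fourier_coeff g) g')"
      using g by (auto simp: L2T_def vcarrier_L2)
  next
    fix G assume G: "G \<in> vcarrier L2T \<and> (\<forall>g'\<in>G. mean_limit (fourier_coeff g) g')"
    then obtain g' where g': "g' \<in> L2_fun torus" "G = ae_class torus g'"
      by (auto simp: L2T_def vcarrier_L2)
    then have "mean_limit (fourier_coeff g) g'"
      using G mem_ae_class_self by blast
    then have "AE x in torus. g' x = g x"
      by (intro fourier_coeff_unique g'(1) g mean_limit_fourier_coeff)
    then show "G = ae_class torus g"
      unfolding g'(2) by (rule ae_class_cong)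
  qed
  finally show ?thesis .
qed

lemma vinner_L2T:
  assumes "f \<in> L2_fun torus" "g \<in> L2_fun torus"
  shows "vinner L2T (ae_class torus f) (ae_class torus g) = l2_inner torus f g"
  unfolding L2T_def l2_inner_def by (subst vinner_L2[OF assms]) (simp_all add: C1_def)

theorem unitary_fourier: "unitary_op ell2 L2T fourier"
  unfolding unitary_op_def
proof (intro conjI ballI allI)
  show "bij_betw fourier (vcarrier ell2) (vcarrier L2T)"
  proof (rule bij_betwI')
    fix c d assume "c \<in> vcarrier ell2" "d \<in> vcarrier ell2"
    then obtain g h where gh: "g \<in> L2_fun torus" "fourier_coeff g = c"
      "h \<in> L2_fun torus" "fourier_coeff h = d"
      by (meson ell2_fourier_coeff)
    have "c = d" if "AE x in torus. g x = h x"
    proof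
      fix k
      show "c k = d k"
        using l2_inner_cong_AE[OF that gh(1,3) trig_L2] gh(2,4) by (auto simp: fourier_coeff_def)
    qed
    then show "fourier c = fourier d \<longleftrightarrow> c = d"
      using fourier_fourier_coeff[OF gh(1)] fourier_fourier_coeff[OF gh(3)]
        ae_class_eq_iff[OF gh(1,3)] gh(2,4) by auto
  next
    fix c assume "c \<in> vcarrier ell2"
    then obtain g where "g \<in> L2_fun torus" "fourier_coeff g = c"
      by (rule ell2_fourier_coeff)
    then show "fourier c \<in> vcarrier L2T"
      using fourier_fourier_coeff by (auto simp: L2T_def vcarrier_L2)
  next
    fix G assume "G \<in> vcarrier L2T"
    then obtain g where "g \<in> L2_fun torus" "G = ae_class torus g"
      by (auto simp: L2T_def vcarrier_L2)
    then show "\<exists>c\<in>vcarrier ell2. G = fourier c"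
      using fourier_fourier_coeff fourier_coeff_ell2 by metis
  qed
next
  fix c d assume "c \<in> vcarrier ell2" "d \<in> vcarrier ell2"
  then obtain g h where gh: "g \<in> L2_fun torus" "fourier_coeff g = c"
    "h \<in> L2_fun torus" "fourier_coeff h = d"
    by (meson ell2_fourier_coeff)
  have "fourier_coeff (\<lambda>x. g x + h x) = vadd ell2 c d"
    using gh by (auto simp: fourier_coeff_def l2_inner_add_left ell2_def)
  then have "fourier (vadd ell2 c d) = ae_class torus (\<lambda>x. g x + h x)"
    using fourier_fourier_coeff[OF L2_fun_add[OF gh(1,3)]] by simp
  then show "fourier (vadd ell2 c d) = vadd L2T (fourier c) (fourier d)"
    using fourier_fourier_coeff[OF gh(1)] fourier_fourier_coeff[OF gh(3)] gh(2,4)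
    by (simp add: L2T_def vadd_L2[OF gh(1,3)]) (simp add: C1_def)
  have "((\<lambda>k. c k * cnj (d k)) has_sum l2_inner torus g h) UNIV"
    using mean_limit_has_sum_inner[OF mean_limit_fourier_series[OF gh(1)] gh(1,3)] gh(2,4) by simp
  then have "vinner ell2 c d = l2_inner torus g h"
    by (simp add: ell2_def infsumI)
  then show "vinner L2T (fourier c) (fourier d) = vinner ell2 c d"
    using fourier_fourier_coeff[OF gh(1)] fourier_fourier_coeff[OF gh(3)] gh(2,4)
    by (simp add: vinner_L2T[OF gh(1,3)])
next
  fix a c assume "c \<in> vcarrier ell2"
  then obtain g where g: "g \<in> L2_fun torus" "fourier_coeff g = c"
    by (rule ell2_fourier_coeff)
  have "fourier_coeff (\<lambda>x. a * g x) = vscale ell2 a c"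
    using g by (auto simp: fourier_coeff_def l2_inner_cmult_left ell2_def)
  then have "fourier (vscale ell2 a c) = ae_class torus (\<lambda>x. a * g x)"
    using fourier_fourier_coeff[OF L2_fun_cmult[OF g(1)], of a] by simp
  then show "fourier (vscale ell2 a c) = vscale L2T a (fourier c)"
    using fourier_fourier_coeff[OF g(1)] g(2)
    by (simp add: L2T_def vscale_L2[OF g(1)]) (simp add: C1_def)
qed

section \<open>The symbol of the Laplace operator\<close>

definition symbol :: "real \<Rightarrow> real" where
  "symbol x = 1 - cos (2 * pi * x)"

lemma borel_measurable_symbol [measurable]: "symbol \<in> borel_measurable borel"
  unfolding symbol_def[abs_def] by measurable

lemma symbol_bounds: "0 \<le> symbol x" "symbol x \<le> 2"
  using cos_le_one[of "2 * pi * x"] cos_ge_minus_one[of "2 * pi * x"] by (auto simp: symbol_def)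

lemma symbol_trig: "complex_of_real (symbol x) = 1 - (trig 1 x + trig (- 1) x) / 2"
  by (simp add: symbol_def trig_cis complex_eq_iff)

lemma symbol_mult_L2:
  fixes g :: "real \<Rightarrow> complex"
  assumes "g \<in> L2_fun torus"
  shows "(\<lambda>x. of_real (symbol x) * g x) \<in> L2_fun torus"
proof (rule L2_fun_bounded_mult[OF assms, of _ 2])
  show "(\<lambda>x. complex_of_real (symbol x)) \<in> borel_measurable torus"
    by (rule measurable_torusI) measurable
  show "norm (complex_of_real (symbol x)) \<le> 2" for x
    using symbol_bounds[of x] by simp
qed

text \<open>The cosine is the mean of the characters with frequencies 1 and -1, and multiplication by a
  character shifts the coefficients by its frequency.\<close>

lemma fourier_coeff_symbol_mult:
  assumes "g \<in> L2_fun torus"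
  shows "fourier_coeff (\<lambda>x. of_real (symbol x) * g x) = laplace (fourier_coeff g)"
proof
  fix k
  have L2: "(\<lambda>x. trig l x * g x) \<in> L2_fun torus" for l
    by (rule L2_fun_bounded_mult[OF assms, of _ 1]) auto
  have shift: "l2_inner torus (\<lambda>x. trig l x * g x) (trig k) = fourier_coeff g (k - l)" for l
    unfolding fourier_coeff_def l2_inner_def cnj_trig
    by (rule Bochner_Integration.integral_cong)
      (simp_all add: mult.commute[of "g _"] trig_mult mult.assoc flip: mult.assoc)
  have "(\<lambda>x. of_real (symbol x) * g x)
      = (\<lambda>x. trig 0 x * g x - (1/2 * (trig 1 x * g x) + 1/2 * (trig (- 1) x * g x)))"
    by (simp add: symbol_trig fun_eq_iff field_simps)
  then have "fourier_coeff (\<lambda>x. of_real (symbol x) * g x) k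
      = fourier_coeff g (k - 0) - (1/2 * fourier_coeff g (k - 1) + 1/2 * fourier_coeff g (k - (- 1)))"
    unfolding shift[symmetric] unfolding fourier_coeff_def
    by (simp only: l2_inner_diff_left l2_inner_add_left l2_inner_cmult_left L2 L2_fun_add
        L2_fun_cmult trig_L2)
  then show "fourier_coeff (\<lambda>x. of_real (symbol x) * g x) k = laplace (fourier_coeff g) k"
    by (simp add: laplace_def field_simps)
qed

section \<open>The change of variables\<close>

lemma space_mu: "space mu = {0..2}"
  by (simp add: mu_def space_restrict_space)

lemma sets_mu: "sets mu = sets (restrict_space borel {0..2})"
  unfolding mu_def sets_density by (rule sets_restrict_space_cong) simp

lemma AE_mu_neq: "AE z in mu. z \<noteq> a"
proof -
  have "AE z in lborel. z \<in> {0..2} \<longrightarrow> z \<noteq> a"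
    using AE_lborel_singleton[of a] by eventually_elim simp
  then have "AE z in restrict_space lborel {0..2}. z \<noteq> a"
    by (subst AE_restrict_space_iff) auto
  moreover have "(\<lambda>z. ennreal (1 / (2 * pi) * (1 / sqrt (z * (2 - z)))))
      \<in> borel_measurable (restrict_space lborel {0..2})"
    by (rule measurable_restrict_space1) measurable
  ultimately show ?thesis unfolding mu_def by (subst AE_density) auto
qed

lemma symbol_measurable_mu: "symbol \<in> measurable M mu" if "symbol \<in> borel_measurable M"
  unfolding measurable_cong_sets[OF refl sets_mu]
  by (rule measurable_restrict_space2[OF _ that]) (simp add: symbol_bounds)

text \<open>The weight of \<^const>\<open>mu\<close> is the reciprocal of the derivative of \<^const>\<open>symbol\<close>, because
  \<open>z * (2 - z) = 1 - (1 - z)\<^sup>2\<close>.\<close>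

lemma weight_symbol:
  assumes "0 < x" "x < 1/2"
  shows "1 / (2 * pi) * (1 / sqrt (symbol x * (2 - symbol x))) * (2 * pi * sin (2 * pi * x)) = 1"
proof -
  have "symbol x * (2 - symbol x) = 1 - (cos (2 * pi * x))\<^sup>2"
    by (simp add: symbol_def power2_eq_square algebra_simps)
  also have "\<dots> = (sin (2 * pi * x))\<^sup>2"
    by (simp add: sin_squared_eq)
  finally have sq: "symbol x * (2 - symbol x) = (sin (2 * pi * x))\<^sup>2" .
  have "0 < sin (2 * pi * x)"
    using assms by (intro sin_gt_zero) auto
  then show ?thesis unfolding sq by simp
qed

text \<open>This is the substitution \<open>z = symbol x\<close>, under which the weight cancels the derivative of
  \<^const>\<open>symbol\<close> away from the endpoints.\<close>

theorem mu_eq_distr: "mu = distr (restrict_space lborel {0..1/2}) mu symbol"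
proof (rule measure_eqI)
  have meas: "symbol \<in> measurable (restrict_space lborel {0..1/2}) mu"
    by (rule symbol_measurable_mu, rule measurable_restrict_space1) measurable
  fix A assume A: "A \<in> sets mu"
  then obtain B where B: "B \<in> sets borel" "A = B \<inter> {0..2}"
    by (auto simp: sets_mu sets_restrict_space)
  then have A': "A \<in> sets borel" by simp
  note [measurable] = A'
  define w where "w z = 1 / (2 * pi) * (1 / sqrt (z * (2 - z)))" for z :: real
  have [measurable]: "w \<in> borel_measurable borel" unfolding w_def by measurable
  have "emeasure mu A = (\<integral>\<^sup>+z. ennreal (w z) * indicator A z \<partial>restrict_space lborel {0..2})"
    unfolding mu_def w_def[symmetric] using A
    by (intro emeasure_density measurable_restrict_space1) (auto simp: mu_def)
  also have "\<dots> = (\<integral>\<^sup>+z. ennreal ((w z * indicator A z) * indicator {symbol 0..symbol (1/2)} z) \<partial>lborel)"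
    by (subst nn_integral_restrict_space)
      (auto intro!: nn_integral_cong simp: indicator_def symbol_def)
  also have "\<dots> = (\<integral>\<^sup>+x. ennreal ((w (symbol x) * indicator A (symbol x)) * (2 * pi * sin (2 * pi * x))
      * indicator {0..1/2} x) \<partial>lborel)"
  proof (rule nn_integral_substitution)
    show "set_borel_measurable borel {symbol 0..symbol (1/2)} (\<lambda>z. w z * indicator A z)"
      unfolding set_borel_measurable_def by measurable
    show "(symbol has_real_derivative 2 * pi * sin (2 * pi * x)) (at x)" for x
      unfolding symbol_def[abs_def] by (auto intro!: derivative_eq_intros)
    show "continuous_on {0..1/2} (\<lambda>x. 2 * pi * sin (2 * pi * x))"
      by (intro continuous_intros)
    show "0 \<le> 2 * pi * sin (2 * pi * x)" if "x \<in> {0..1/2}" for x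
      using that by (intro mult_nonneg_nonneg sin_ge_zero) auto
  qed simp
  also have "\<dots> = (\<integral>\<^sup>+x. indicator (symbol -` A \<inter> {0..1/2}) x \<partial>lborel)"
  proof (rule nn_integral_cong_AE)
    show "AE x in lborel. ennreal (w (symbol x) * indicator A (symbol x) * (2 * pi * sin (2 * pi * x))
        * indicator {0..1/2} x) = indicator (symbol -` A \<inter> {0..1/2}) x"
      using AE_lborel_singleton[of 0] AE_lborel_singleton[of "1/2"]
    proof eventually_elim
      case (elim x)
      show ?case
      proof (cases "x \<in> {0..1/2}")
        case True
        then have "w (symbol x) * (2 * pi * sin (2 * pi * x)) = 1"
          unfolding w_def using elim by (intro weight_symbol) auto
        then have eq: "w (symbol x) * indicator A (symbol x) * (2 * pi * sin (2 * pi * x))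
            = indicator A (symbol x)"
          by (subst mult.commute[of "w (symbol x)"], subst mult.assoc)
            (simp only: mult_1_right)
        show ?thesis unfolding eq using True by (simp add: indicator_def)
      qed simp
    qed
  qed
  also have "\<dots> = emeasure lborel (symbol -` A \<inter> {0..1/2})"
  proof -
    have "symbol -` A \<inter> space borel \<in> sets borel" by measurable
    then show ?thesis by (intro nn_integral_indicator) auto
  qed
  also have "\<dots> = emeasure (distr (restrict_space lborel {0..1/2}) mu symbol) A"
    by (subst emeasure_distr[OF meas A], subst emeasure_restrict_space)
      (auto simp: space_restrict_space)
  finally show "emeasure mu A = emeasure (distr (restrict_space lborel {0..1/2}) mu symbol) A" .
qed simp

text \<open>The point of the fundamental interval \<open>[-1/2, 1/2)\<close> that represents \<open>x\<close> modulo 1.\<close>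

definition wrap :: "real \<Rightarrow> real" where
  "wrap x = frac (x + 1/2) - 1/2"

text \<open>The two inverse branches of \<^const>\<open>symbol\<close>: up to endpoints, \<open>upper\<close> takes values in \<open>(0, 1/2)\<close> and \<open>lower\<close> in
  \<open>(-1/2, 0)\<close>.\<close>

definition upper :: "real \<Rightarrow> real" where
  "upper z = wrap (1 / (2 * pi) * arccos (1 - z))"

definition lower :: "real \<Rightarrow> real" where
  "lower z = wrap (1 - 1 / (2 * pi) * arccos (1 - z))"

lemma wrap_eqI:
  assumes "-1/2 \<le> y" "y < 1/2" "x = y + of_int n"
  shows "wrap x = y"
proof -
  have "\<lfloor>x + 1/2\<rfloor> = n" using assms by (intro floor_unique) auto
  then show ?thesis using assms(3) by (simp add: wrap_def frac_def)
qed

lemma wrap_torus: "wrap x \<in> space torus"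
  using frac_ge_0[of "x + 1/2"] frac_lt_1[of "x + 1/2"] by (simp add: wrap_def space_torus)

lemma symbol_wrap: "symbol (wrap x) = symbol x"
proof -
  have "2 * pi * wrap x = 2 * pi * x + 2 * pi * of_int (- \<lfloor>x + 1/2\<rfloor>)"
    by (simp add: wrap_def frac_def algebra_simps)
  then have "cos (2 * pi * wrap x) = cos (2 * pi * x)"
    using sin_cos_eq_iff by blast
  then show ?thesis by (simp add: symbol_def)
qed

lemma symbol_upper: "z \<in> space mu \<Longrightarrow> symbol (upper z) = z"
  by (simp add: upper_def symbol_wrap space_mu) (simp add: symbol_def)

lemma symbol_lower:
  assumes "z \<in> space mu"
  shows "symbol (lower z) = z"
proof -
  have "symbol (lower z) = 1 - cos (2 * pi - arccos (1 - z))"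
    by (simp add: lower_def symbol_wrap) (simp add: symbol_def right_diff_distrib)
  also have "cos (2 * pi - arccos (1 - z)) = cos (arccos (1 - z))"
    by (simp add: cos_diff)
  finally show ?thesis using assms by (simp add: space_mu)
qed

lemma arccos_symbol:
  assumes "0 \<le> x" "x \<le> 1/2"
  shows "1 / (2 * pi) * arccos (1 - symbol x) = x"
proof -
  have "2 * pi * x \<le> 2 * pi * (1/2)" by (intro mult_left_mono assms) simp
  then have "arccos (cos (2 * pi * x)) = 2 * pi * x" using assms by (intro arccos_cos) auto
  then show ?thesis by (simp add: symbol_def)
qed

lemma upper_symbol: "0 \<le> x \<Longrightarrow> x < 1/2 \<Longrightarrow> upper (symbol x) = x"
  unfolding upper_def by (subst arccos_symbol) (auto intro: wrap_eqI[where n = 0])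

lemma lower_symbol: "0 \<le> x \<Longrightarrow> x \<le> 1/2 \<Longrightarrow> lower (symbol x) = - x"
  unfolding lower_def by (subst arccos_symbol) (auto intro: wrap_eqI[where n = 1])

lemma ex_symbol:
  assumes "z \<in> space mu"
  obtains x where "0 \<le> x" "x \<le> 1/2" "symbol x = z"
proof (rule that)
  show "0 \<le> 1 / (2 * pi) * arccos (1 - z)"
    using assms by (simp add: space_mu arccos_lbound)
  show "1 / (2 * pi) * arccos (1 - z) \<le> 1/2"
    using assms arccos_ubound[of "1 - z"] by (simp add: space_mu field_simps)
  show "symbol (1 / (2 * pi) * arccos (1 - z)) = z"
    using assms by (simp add: symbol_def space_mu)
qed

text \<open>The point 2 is an exception because \<open>1/2\<close> is represented by \<open>-1/2\<close>.\<close>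

lemma upper_nonneg:
  assumes "z \<in> space mu" "z \<noteq> 2"
  shows "0 \<le> upper z"
proof -
  obtain x where x: "0 \<le> x" "x \<le> 1/2" "symbol x = z" using ex_symbol[OF assms(1)] .
  have "symbol (1/2) = 2" by (simp add: symbol_def)
  then have "x \<noteq> 1/2" using assms(2) x(3) by blast
  then show ?thesis using upper_symbol[of x] x by simp
qed

lemma lower_neg:
  assumes "z \<in> space mu" "z \<noteq> 0"
  shows "lower z < 0"
proof -
  obtain x where x: "0 \<le> x" "x \<le> 1/2" "symbol x = z" using ex_symbol[OF assms(1)] .
  then have "x \<noteq> 0" using assms(2) by (auto simp: symbol_def)
  then show ?thesis using lower_symbol[of x] x by simp
qed

lemma measurable_wrap: "f \<in> borel_measurable mu \<Longrightarrow> (\<lambda>z. wrap (f z)) \<in> measurable mu torus"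
  unfolding measurable_cong_sets[OF refl sets_torus]
proof (rule measurable_restrict_space2)
  assume [measurable]: "f \<in> borel_measurable mu"
  show "(\<lambda>z. wrap (f z)) \<in> borel_measurable mu"
    unfolding wrap_def frac_def by measurable
qed (use wrap_torus in \<open>simp add: space_torus\<close>)

lemma borel_measurable_arccos_mu [measurable]: "(\<lambda>z. arccos (1 - z)) \<in> borel_measurable mu"
  unfolding measurable_cong_sets[OF sets_mu refl]
  by (rule borel_measurable_continuous_on_restrict) (auto intro!: continuous_intros)

lemma measurable_upper [measurable]: "upper \<in> measurable mu torus"
  unfolding upper_def[abs_def] by (rule measurable_wrap) measurable

lemma measurable_lower [measurable]: "lower \<in> measurable mu torus"
  unfolding lower_def[abs_def] by (rule measurable_wrap) measurable

text \<open>Since \<^const>\<open>mu\<close> is the image of Lebesgue measure under \<^const>\<open>symbol\<close>, a branch \<open>p\<close> needs to be known only as a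
  function \<open>q\<close> of the coordinate on \<open>[0, 1/2]\<close>, and there only away from the endpoints.\<close>

lemma emeasure_distr_mu:
  assumes p: "p \<in> measurable mu torus" and A: "A \<in> sets torus"
    and q: "q \<in> borel_measurable borel" "\<And>x. 0 < x \<Longrightarrow> x < 1/2 \<Longrightarrow> p (symbol x) = q x"
  shows "emeasure (distr mu torus p) A = emeasure lborel (q -` A \<inter> {0<..<1/2})"
proof -
  let ?R = "restrict_space lborel {0..1/2 :: real}"
  have s: "symbol \<in> measurable ?R mu"
    by (rule symbol_measurable_mu, rule measurable_restrict_space1) measurable
  have ps: "p \<circ> symbol \<in> measurable ?R torus" by (rule measurable_comp[OF s p])
  have "distr mu torus p = distr (distr ?R mu symbol) torus p"
    using mu_eq_distr by simp
  also have "\<dots> = distr ?R torus (p \<circ> symbol)"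
    by (rule distr_distr[OF p s])
  finally have "emeasure (distr mu torus p) A = emeasure ?R ((p \<circ> symbol) -` A \<inter> {0..1/2})"
    using A by (simp add: emeasure_distr[OF ps] space_restrict_space)
  also have "\<dots> = emeasure lborel ((p \<circ> symbol) -` A \<inter> {0..1/2})"
    by (rule emeasure_restrict_space) auto
  also have "\<dots> = emeasure lborel (q -` A \<inter> {0<..<1/2})"
  proof (rule emeasure_eq_AE)
    show "AE x in lborel. x \<in> (p \<circ> symbol) -` A \<inter> {0..1/2} \<longleftrightarrow> x \<in> q -` A \<inter> {0<..<1/2}"
      using AE_lborel_singleton[of 0] AE_lborel_singleton[of "1/2"]
    proof eventually_elim
      case (elim x)
      then show ?case using q(2)[of x] by (cases "0 < x \<and> x < 1/2") auto
    qed
    show "(p \<circ> symbol) -` A \<inter> {0..1/2} \<in> sets lborel"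
      using measurable_sets[OF ps A] by (simp add: sets_restrict_space_iff space_restrict_space)
    have "A \<in> sets borel" using A by (auto simp: sets_torus sets_restrict_space)
    then have "q -` A \<inter> space borel \<in> sets borel" by (rule measurable_sets[OF q(1)])
    then show "q -` A \<inter> {0<..<1/2} \<in> sets lborel" by simp
  qed
  finally show ?thesis .
qed

lemma emeasure_density_torus:
  assumes "B \<in> sets borel" "B \<subseteq> {-1/2..<1/2}" "A \<in> sets torus"
  shows "emeasure (density torus (\<lambda>x. ennreal (indicator B x))) A = emeasure lborel (A \<inter> B)"
proof -
  have A: "A \<in> sets borel" using assms(3) by (auto simp: sets_torus sets_restrict_space)
  have "(\<lambda>x. ennreal (indicator B x)) \<in> borel_measurable torus"
    using assms(1) by (intro measurable_torusI borel_measurable_indicator measurable_compose[OF _ measurable_ennreal])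
  then have "emeasure (density torus (\<lambda>x. ennreal (indicator B x))) A
      = (\<integral>\<^sup>+x. ennreal (indicator B x) * indicator A x \<partial>torus)"
    using assms(3) by (rule emeasure_density)
  also have "\<dots> = (\<integral>\<^sup>+x. indicator (A \<inter> B) x \<partial>lborel)"
    unfolding torus_def using assms(2)
    by (subst nn_integral_restrict_space) (auto intro!: nn_integral_cong simp: indicator_def)
  also have "\<dots> = emeasure lborel (A \<inter> B)"
    using A assms(1) by (intro nn_integral_indicator) auto
  finally show ?thesis .
qed

text \<open>The branches carry \<^const>\<open>mu\<close> to the restrictions of Haar measure to the two halves of the torus.\<close>

lemma distr_upper: "distr mu torus upper = density torus (\<lambda>x. ennreal (indicator {0<..<1/2} x))"
proof (rule measure_eqI)
  fix A assume "A \<in> sets (distr mu torus upper)"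
  then have A: "A \<in> sets torus" by simp
  have "emeasure (distr mu torus upper) A = emeasure lborel ((\<lambda>x. x) -` A \<inter> {0<..<1/2})"
    by (rule emeasure_distr_mu[OF measurable_upper A]) (auto simp: upper_symbol)
  then show "emeasure (distr mu torus upper) A
      = emeasure (density torus (\<lambda>x. ennreal (indicator {0<..<1/2} x))) A"
    using A by (subst emeasure_density_torus) auto
qed simp

lemma distr_lower: "distr mu torus lower = density torus (\<lambda>x. ennreal (indicator {-1/2<..<0} x))"
proof (rule measure_eqI)
  fix A assume "A \<in> sets (distr mu torus lower)"
  then have A: "A \<in> sets torus" by simp
  then have "A \<in> sets borel" by (auto simp: sets_torus sets_restrict_space)
  then have B: "A \<inter> {-1/2<..<0} \<in> sets borel" by simp
  have "emeasure (distr mu torus lower) A = emeasure lborel (uminus -` A \<inter> {0<..<1/2})"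
    by (rule emeasure_distr_mu[OF measurable_lower A]) (auto simp: lower_symbol)
  also have "uminus -` A \<inter> {0<..<1/2} = uminus -` (A \<inter> {-1/2<..<0})" by auto
  also have "emeasure lborel (uminus -` (A \<inter> {-1/2<..<0 :: real}))
      = emeasure (distr lborel borel uminus) (A \<inter> {-1/2<..<0})"
    using B by (subst emeasure_distr) auto
  also have "\<dots> = emeasure lborel (A \<inter> {-1/2<..<0})"
    by (simp add: lborel_distr_uminus)
  also have "\<dots> = emeasure (density torus (\<lambda>x. ennreal (indicator {-1/2<..<0} x))) A"
    using A by (subst emeasure_density_torus) auto
  finally show "emeasure (distr mu torus lower) A
      = emeasure (density torus (\<lambda>x. ennreal (indicator {-1/2<..<0} x))) A" .
qed simp

lemma borel_measurable_indicator_torus: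
  "B \<in> sets borel \<Longrightarrow> (indicator B :: real \<Rightarrow> real) \<in> borel_measurable torus"
  by (intro measurable_torusI borel_measurable_indicator)

lemma AE_upper:
  assumes "AE x in torus. P x"
  shows "AE z in mu. P (upper z)"
proof (rule AE_distrD[OF measurable_upper])
  show "AE x in distr mu torus upper. P x"
    unfolding distr_upper using assms borel_measurable_indicator_torus
    by (subst AE_density) auto
qed

lemma AE_lower:
  assumes "AE x in torus. P x"
  shows "AE z in mu. P (lower z)"
proof (rule AE_distrD[OF measurable_lower])
  show "AE x in distr mu torus lower. P x"
    unfolding distr_lower using assms borel_measurable_indicator_torus
    by (subst AE_density) auto
qed

lemma indicator_halves_AE:
  "AE x in torus. (indicator {0<..<1/2} x + indicator {-1/2<..<0} x :: real) = 1"
proof -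
  have "AE x in lborel. x \<in> {-1/2..<1/2 :: real} \<longrightarrow> (indicator {0<..<1/2} x + indicator {-1/2<..<0} x :: real) = 1"
    using AE_lborel_singleton[of "0::real"] AE_lborel_singleton[of "-1/2::real"]
    by eventually_elim (auto simp: indicator_def)
  then show ?thesis by (rule AE_torusI)
qed

context
  fixes F :: "real \<Rightarrow> 'b::{banach, second_countable_topology}"
  assumes F [measurable]: "F \<in> borel_measurable torus"
begin

lemma upper_half:
  "integrable mu (\<lambda>z. F (upper z)) \<longleftrightarrow> integrable torus (\<lambda>x. indicator {0<..<1/2} x *\<^sub>R F x)"
  "(LINT z|mu. F (upper z)) = (LINT x|torus. indicator {0<..<1/2} x *\<^sub>R F x)"
  using borel_measurable_indicator_torus[of "{0<..<1/2}"]
    integrable_distr_eq[OF measurable_upper F] integral_distr[OF measurable_upper F]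
  by (simp_all add: distr_upper integrable_density integral_density F)

lemma lower_half:
  "integrable mu (\<lambda>z. F (lower z)) \<longleftrightarrow> integrable torus (\<lambda>x. indicator {-1/2<..<0} x *\<^sub>R F x)"
  "(LINT z|mu. F (lower z)) = (LINT x|torus. indicator {-1/2<..<0} x *\<^sub>R F x)"
  using borel_measurable_indicator_torus[of "{-1/2<..<0}"]
    integrable_distr_eq[OF measurable_lower F] integral_distr[OF measurable_lower F]
  by (simp_all add: distr_lower integrable_density integral_density F)

lemma integrable_torus_iff:
  "integrable torus F \<longleftrightarrow> integrable mu (\<lambda>z. F (upper z)) \<and> integrable mu (\<lambda>z. F (lower z))"
proof
  assume int: "integrable torus F"
  have "{0<..<1/2} \<in> sets torus" "{-1/2<..<0} \<in> sets torus"
    unfolding sets_torus by (auto simp: sets_restrict_space_iff)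
  then show "integrable mu (\<lambda>z. F (upper z)) \<and> integrable mu (\<lambda>z. F (lower z))"
    unfolding upper_half lower_half using int by (simp add: integrable_mult_indicator)
next
  assume "integrable mu (\<lambda>z. F (upper z)) \<and> integrable mu (\<lambda>z. F (lower z))"
  then have "integrable torus (\<lambda>x. indicator {0<..<1/2} x *\<^sub>R F x + indicator {-1/2<..<0} x *\<^sub>R F x)"
    unfolding upper_half lower_half by simp
  then show "integrable torus F"
  proof (rule integrable_cong_AE_imp[OF _ F])
    show "AE x in torus. indicator {0<..<1/2} x *\<^sub>R F x + indicator {-1/2<..<0} x *\<^sub>R F x = F x"
      using indicator_halves_AE by eventually_elim (simp flip: scaleR_add_left)
  qed
qed

text \<open>The two halves exhaust the torus up to a null set, so an integral over the torus is a sum of two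
  integrals over \<open>[0, 2]\<close>.\<close>

lemma integral_torus_split:
  assumes "integrable torus F"
  shows "(LINT x|torus. F x) = (LINT z|mu. F (upper z) + F (lower z))"
proof -
  note int = assms[unfolded integrable_torus_iff]
  have "(LINT z|mu. F (upper z) + F (lower z))
      = (LINT x|torus. indicator {0<..<1/2} x *\<^sub>R F x + indicator {-1/2<..<0} x *\<^sub>R F x)"
    using int by (simp add: upper_half lower_half)
  also have "\<dots> = (LINT x|torus. F x)"
  proof (rule integral_cong_AE)
    show "AE x in torus. indicator {0<..<1/2} x *\<^sub>R F x + indicator {-1/2<..<0} x *\<^sub>R F x = F x"
      using indicator_halves_AE by eventually_elim (simp flip: scaleR_add_left)
    show "(\<lambda>x. indicator {0<..<1/2} x *\<^sub>R F x + indicator {-1/2<..<0} x *\<^sub>R F x) \<in> borel_measurable torus"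
      using int unfolding upper_half lower_half
      by (intro borel_measurable_add borel_measurable_integrable) auto
  qed (rule F)
  finally show ?thesis ..
qed

end

section \<open>The unitary operator onto the spectral representation\<close>

text \<open>The operator \<^const>\<open>W\<close> on representatives.\<close>

definition branches :: "(real \<Rightarrow> complex) \<Rightarrow> real \<Rightarrow> complex \<times> complex" where
  "branches g z = (g (upper z), g (lower z))"

lemma branches_measurable:
  "g \<in> borel_measurable torus \<Longrightarrow> branches g \<in> borel_measurable mu"
  unfolding branches_def[abs_def]
  by (intro borel_measurable_Pair measurable_compose[OF measurable_upper]
      measurable_compose[OF measurable_lower])

lemma norm_Pair_sq: "(norm (a, b))\<^sup>2 = (norm a)\<^sup>2 + (norm b)\<^sup>2"
  by (simp add: norm_Pair)

lemma branches_L2_iff: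
  assumes "g \<in> borel_measurable torus"
  shows "branches g \<in> L2_fun mu \<longleftrightarrow> g \<in> L2_fun torus"
proof -
  note [measurable] = assms branches_measurable[OF assms]
  have "integrable mu (\<lambda>z. (norm (branches g z))\<^sup>2) \<longleftrightarrow>
      integrable mu (\<lambda>z. (cmod (g (upper z)))\<^sup>2) \<and> integrable mu (\<lambda>z. (cmod (g (lower z)))\<^sup>2)"
    (is "?L \<longleftrightarrow> ?R")
  proof
    assume int: ?L
    have "(\<lambda>z. (cmod (g (upper z)))\<^sup>2) \<in> borel_measurable mu"
      "(\<lambda>z. (cmod (g (lower z)))\<^sup>2) \<in> borel_measurable mu"
      by measurable
    then show ?R
      by (auto intro!: Bochner_Integration.integrable_bound[OF int]
          simp: branches_def norm_Pair_sq)
  next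
    assume ?R
    then show ?L by (simp add: branches_def norm_Pair_sq)
  qed
  also have "\<dots> \<longleftrightarrow> integrable torus (\<lambda>x. (cmod (g x))\<^sup>2)"
    by (rule integrable_torus_iff[symmetric]) measurable
  finally show ?thesis using branches_measurable[OF assms] assms by (simp add: L2_fun_def)
qed

lemma branches_L2: "g \<in> L2_fun torus \<Longrightarrow> branches g \<in> L2_fun mu"
  using branches_L2_iff L2_funD(1) by blast

lemma branches_AE_cong:
  assumes "AE x in torus. f x = g x"
  shows "AE z in mu. branches f z = branches g z"
  using AE_upper[OF assms] AE_lower[OF assms] by eventually_elim (simp add: branches_def)

lemma branches_AE_eqD:
  assumes f: "f \<in> L2_fun torus" and g: "g \<in> L2_fun torus"
    and eq: "AE z in mu. branches f z = branches g z"
  shows "AE x in torus. f x = g x"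
proof -
  have d: "(\<lambda>x. f x - g x) \<in> L2_fun torus" by (rule L2_fun_diff[OF f g])
  note int = L2_funD(2)[OF d]
  have "(LINT x|torus. (cmod (f x - g x))\<^sup>2)
      = (LINT z|mu. (cmod (f (upper z) - g (upper z)))\<^sup>2 + (cmod (f (lower z) - g (lower z)))\<^sup>2)"
    using int by (intro integral_torus_split) auto
  also have "\<dots> = 0"
  proof (rule integral_eq_zero_AE)
    show "AE z in mu. (cmod (f (upper z) - g (upper z)))\<^sup>2 + (cmod (f (lower z) - g (lower z)))\<^sup>2 = 0"
      using eq by eventually_elim (simp add: branches_def)
  qed
  finally have "AE x in torus. (cmod (f x - g x))\<^sup>2 = 0"
    using integral_nonneg_eq_0_iff_AE[OF int] by simp
  then show ?thesis by eventually_elim simp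
qed

lemma borel_measurable_fst_snd [measurable (raw)]:
  fixes h :: "'a \<Rightarrow> 'b::topological_space \<times> 'c::topological_space"
  assumes "h \<in> borel_measurable M"
  shows "(\<lambda>x. fst (h x)) \<in> borel_measurable M" "(\<lambda>x. snd (h x)) \<in> borel_measurable M"
  by (rule borel_measurable_continuous_on[OF continuous_on_fst[OF continuous_on_id] assms]
      borel_measurable_continuous_on[OF continuous_on_snd[OF continuous_on_id] assms])+

text \<open>A preimage of \<open>h\<close> is glued from its two components: the first is moved to the half with \<open>0 \<le> x\<close>, the
  second to the other one.\<close>

lemma branches_surj:
  assumes h: "h \<in> L2_fun mu"
  obtains g where "g \<in> L2_fun torus" "AE z in mu. branches g z = h z"
proof -
  define g where "g x = (if 0 \<le> x then fst (h (symbol x)) else snd (h (symbol x)))" for x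
  have [measurable]: "h \<in> borel_measurable mu" by (rule L2_funD(1)[OF h])
  have [measurable]: "symbol \<in> measurable torus mu"
    by (rule symbol_measurable_mu, rule measurable_torusI) measurable
  have [measurable]: "(\<lambda>x. x) \<in> borel_measurable torus"
    by (rule measurable_torusI) measurable
  have meas: "g \<in> borel_measurable torus"
    unfolding g_def by measurable
  have eq: "AE z in mu. branches g z = h z"
    using AE_mu_neq[of 0] AE_mu_neq[of 2] AE_space
  proof eventually_elim
    case (elim z)
    then have "0 \<le> upper z" "\<not> 0 \<le> lower z"
      using upper_nonneg[of z] lower_neg[of z] by auto
    then show ?case using elim
      by (simp add: branches_def g_def symbol_upper symbol_lower)
  qed
  have "branches g \<in> L2_fun mu"
    by (rule L2_fun_AE_cong[OF h branches_measurable[OF meas]])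
      (use eq in eventually_elim, simp)
  then have "g \<in> L2_fun torus" using branches_L2_iff[OF meas] by blast
  then show ?thesis using eq by (rule that)
qed

lemma W_ae_class:
  assumes "g \<in> L2_fun torus"
  shows "W (ae_class torus g) = ae_class mu (branches g)"
proof -
  have "W G = (\<Union>g\<in>G. ae_class mu (branches g))" for G
    by (simp add: W_def branches_def[abs_def] periodic_ext_def upper_def lower_def wrap_def)
  then show ?thesis
    using UN_ae_class[where \<Phi> = branches and N = mu, OF assms branches_AE_cong] by simp
qed

lemma vinner_C2_measurable:
  assumes [measurable]: "f \<in> borel_measurable M" "g \<in> borel_measurable M"
  shows "(\<lambda>x. vinner C2 (f x) (g x)) \<in> borel_measurable M"
proof -
  have "(\<lambda>x. vinner C2 (f x) (g x))
      = (\<lambda>x. fst (f x) * cnj (fst (g x)) + snd (f x) * cnj (snd (g x)))"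
    by (simp add: C2_def case_prod_beta)
  then show ?thesis by simp
qed

lemma unitary_op_comp:
  assumes S: "unitary_op V1 V2 S" and T: "unitary_op V2 V3 T"
  shows "unitary_op V1 V3 (T \<circ> S)"
proof -
  have "S x \<in> vcarrier V2" if "x \<in> vcarrier V1" for x
    using S that by (auto simp: unitary_op_def bij_betw_def)
  then show ?thesis
    using S T bij_betw_trans by (auto simp: unitary_op_def)
qed

theorem unitary_W: "unitary_op L2T X W"
  unfolding unitary_op_def
proof (intro conjI ballI allI)
  show "bij_betw W (vcarrier L2T) (vcarrier X)"
  proof (rule bij_betwI')
    fix F G assume "F \<in> vcarrier L2T" "G \<in> vcarrier L2T"
    then obtain f g where fg: "f \<in> L2_fun torus" "F = ae_class torus f"
      "g \<in> L2_fun torus" "G = ae_class torus g"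
      by (auto simp: L2T_def vcarrier_L2)
    have "(AE z in mu. branches f z = branches g z) \<longleftrightarrow> (AE x in torus. f x = g x)"
      using branches_AE_eqD[OF fg(1,3)] branches_AE_cong by blast
    then show "W F = W G \<longleftrightarrow> F = G"
      by (simp add: fg(2,4) W_ae_class fg(1,3) ae_class_eq_iff branches_L2)
  next
    fix F assume "F \<in> vcarrier L2T"
    then show "W F \<in> vcarrier X"
      by (auto simp: L2T_def X_def vcarrier_L2 W_ae_class branches_L2)
  next
    fix H assume "H \<in> vcarrier X"
    then obtain h where h: "h \<in> L2_fun mu" "H = ae_class mu h"
      by (auto simp: X_def vcarrier_L2)
    obtain g where g: "g \<in> L2_fun torus" "AE z in mu. branches g z = h z"
      using branches_surj[OF h(1)] .
    have "H = W (ae_class torus g)"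
      using ae_class_cong[OF g(2)] by (simp add: W_ae_class g(1) h(2))
    then show "\<exists>F\<in>vcarrier L2T. H = W F"
      using g(1) by (auto simp: L2T_def vcarrier_L2)
  qed
next
  fix F G assume "F \<in> vcarrier L2T" "G \<in> vcarrier L2T"
  then obtain f g where fg: "f \<in> L2_fun torus" "F = ae_class torus f"
    "g \<in> L2_fun torus" "G = ae_class torus g"
    by (auto simp: L2T_def vcarrier_L2)
  have "W (vadd L2T F G) = ae_class mu (branches (\<lambda>x. f x + g x))"
    unfolding fg(2,4) L2T_def vadd_L2[OF fg(1,3)]
    by (simp add: C1_def W_ae_class L2_fun_add fg(1,3))
  also have "\<dots> = vadd X (W F) (W G)"
    unfolding fg(2,4) X_def W_ae_class[OF fg(1)] W_ae_class[OF fg(3)]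
      vadd_L2[OF branches_L2[OF fg(1)] branches_L2[OF fg(3)]]
    by (simp add: C2_def branches_def[abs_def])
  finally show "W (vadd L2T F G) = vadd X (W F) (W G)" .
  have "vinner X (W F) (W G) = (LINT z|mu. vinner C2 (branches f z) (branches g z))"
    unfolding fg(2,4) X_def W_ae_class[OF fg(1)] W_ae_class[OF fg(3)]
    by (rule vinner_L2[OF branches_L2[OF fg(1)] branches_L2[OF fg(3)] vinner_C2_measurable])
  also have "\<dots> = l2_inner torus f g"
    using integral_torus_split[OF _ integrable_mult_cnj[OF fg(1,3)]]
      borel_measurable_integrable[OF integrable_mult_cnj[OF fg(1,3)]]
    by (simp add: l2_inner_def C2_def branches_def)
  also have "\<dots> = vinner L2T F G"
    unfolding fg(2,4) by (rule vinner_L2T[OF fg(1,3), symmetric])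
  finally show "vinner X (W F) (W G) = vinner L2T F G" .
next
  fix c F assume "F \<in> vcarrier L2T"
  then obtain f where f: "f \<in> L2_fun torus" "F = ae_class torus f"
    by (auto simp: L2T_def vcarrier_L2)
  have "W (vscale L2T c F) = ae_class mu (branches (\<lambda>x. c * f x))"
    unfolding f(2) L2T_def vscale_L2[OF f(1)]
    by (simp add: C1_def W_ae_class L2_fun_cmult f(1))
  also have "\<dots> = vscale X c (W F)"
    unfolding f(2) X_def W_ae_class[OF f(1)] vscale_L2[OF branches_L2[OF f(1)]]
    by (simp add: C2_def branches_def[abs_def])
  finally show "W (vscale L2T c F) = vscale X c (W F)" .
qed

lemma Mz_ae_class:
  assumes "h \<in> L2_fun mu"
  shows "Mz (ae_class mu h) = ae_class mu (\<lambda>z. z *\<^sub>R h z)"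
  unfolding Mz_def by (rule UN_ae_class[OF assms]) (erule eventually_mono, simp)

text \<open>Both branches are right inverses of \<^const>\<open>symbol\<close>, so along either of them \<open>symbol x\<close> is \<open>z\<close>.\<close>

theorem W_symbol_mult:
  assumes g: "g \<in> L2_fun torus"
  shows "W (ae_class torus (\<lambda>x. of_real (symbol x) * g x)) = Mz (W (ae_class torus g))"
proof -
  have "AE z in mu. branches (\<lambda>x. of_real (symbol x) * g x) z = z *\<^sub>R branches g z"
    using AE_space by eventually_elim
      (simp add: branches_def symbol_upper symbol_lower scaleR_conv_of_real)
  then show ?thesis
    unfolding W_ae_class[OF g] Mz_ae_class[OF branches_L2[OF g]] W_ae_class[OF symbol_mult_L2[OF g]]
    by (rule ae_class_cong)
qed

text \<open>If \<open>f = fourier_coeff g\<close>, then \<open>laplace f\<close> consists of the coefficients of the square integrable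
  function \<open>symbol * g\<close>. Hence it is square summable, and \<open>U\<close> sends it to \<open>Mz (U f)\<close>.\<close>

theorem theorem3p3:
  "unitary_op ell2 X U \<and>
   (\<forall>f\<in>vcarrier ell2. laplace f = inv_into (vcarrier ell2) U (Mz (U f)))"
proof
  show unitary: "unitary_op ell2 X U"
    unfolding U_def by (rule unitary_op_comp[OF unitary_fourier unitary_W])
  show "\<forall>f\<in>vcarrier ell2. laplace f = inv_into (vcarrier ell2) U (Mz (U f))"
  proof
    fix f assume "f \<in> vcarrier ell2"
    then obtain g where g: "g \<in> L2_fun torus" "fourier_coeff g = f"
      by (rule ell2_fourier_coeff)
    let ?g = "\<lambda>x. of_real (symbol x) * g x"
    have g': "?g \<in> L2_fun torus" "fourier_coeff ?g = laplace f"
      using symbol_mult_L2[OF g(1)] fourier_coeff_symbol_mult[OF g(1)] g(2) by auto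
    have "laplace f \<in> vcarrier ell2"
      using fourier_coeff_ell2[OF g'(1)] g'(2) by simp
    moreover have "U (laplace f) = Mz (U f)"
      using W_symbol_mult[OF g(1)] fourier_fourier_coeff[OF g(1)] fourier_fourier_coeff[OF g'(1)]
        g(2) g'(2) by (simp add: U_def)
    moreover have "inj_on U (vcarrier ell2)"
      using unitary by (simp add: unitary_op_def bij_betw_def)
    ultimately show "laplace f = inv_into (vcarrier ell2) U (Mz (U f))"
      by (metis inv_into_f_f)
  qed
qed

end
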